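(* There is a universal constant $C>0$ such that the following holds. Let $M,N\ge 1$ be integers, let $Q\subset\mathbb{R}^N$ be a non-empty subset of the Euclidean unit ball, and let $E\subset\mathbb{R}^M$ be a non-empty closed set with permutation symmetry. Let $A\in\mathbb{R}^{M\times N}$ be a random matrix with independent standard normal entries. Then for every $q\in[2,\infty]$, $$\operatorname{Var}\big(\mathcal{M}_q(A)\big)\le \frac{C}{1+\left(\frac12-\frac1q\right)\log M},$$ where $\mathcal{M}_q(A)=\mathcal{M}_{q,Q,E}(A)$ is the $\ell^q$-margin.
   Context: A set $E\subset\mathbb{R}^M$ has permutation symmetry if for every permutation $\pi\in S_M$ and every $x\in\mathbb{R}^M$: $(x_1,\dots,x_M)\in E$ if and only if $(x_{\pi(1)},\dots,x_{\pi(M)})\in E$. For $Q\subset\mathbb{R}^N$ (the feasible set), $E\subset\mathbb{R}^M$ (the constraint set) and a matrix $A\in\mathbb{R}^{M\times N}$, the $\ell^q$-margin is $$\mathcal{M}_q(A):=\mathcal{M}_{q,Q,E}(A):=\min_{\sigma\in Q} d_{\ell^q}(A\sigma,E),\qquad d_{\ell^q}(x,E)=\inf_{y\in E}\|x-y\|_q,$$ where the minimum over $Q$ is understood as an infimum if it is not attained. Convention: $1/q=0$ when $q=\infty$. *)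

theory Defs
  imports "HOL-Probability.Probability"
begin

text \<open>
  Dimensions vary inside the statement, so \<open>\<real>\<^sup>n\<close> is the space
  \<^const>\<open>Euclidean_space\<close> \<open>n\<close> of \<open>HOL-Analysis\<close>: real sequences vanishing at all
  indices \<open>\<ge> n\<close>, with its usual topology. Coordinates are indexed by \<open>{..<n}\<close>, and an
  \<open>m \<times> n\<close> matrix is a function of index pairs, used only on \<open>{..<m} \<times> {..<n}\<close>.
\<close>

definition permutation_symmetric :: "nat \<Rightarrow> (nat \<Rightarrow> real) set \<Rightarrow> bool"
  where "permutation_symmetric m E \<longleftrightarrow>
    (\<forall>\<pi>. \<pi> permutes {..<m} \<longrightarrow>
      (\<forall>x\<in>topspace (Euclidean_space m). x \<in> E \<longleftrightarrow> (\<lambda>i. x (\<pi> i)) \<in> E))"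

definition mat_vec :: "nat \<Rightarrow> nat \<Rightarrow> (nat \<times> nat \<Rightarrow> real) \<Rightarrow> (nat \<Rightarrow> real) \<Rightarrow> (nat \<Rightarrow> real)"
  where "mat_vec m n A v = (\<lambda>i. if i < m then (\<Sum>j<n. A (i, j) * v j) else 0)"

text \<open>Meaningful for \<open>m \<ge> 1\<close> and \<open>1 \<le> q \<le> \<infinity>\<close>.\<close>

definition lq_norm :: "ereal \<Rightarrow> nat \<Rightarrow> (nat \<Rightarrow> real) \<Rightarrow> real"
  where "lq_norm q m x =
    (if q = \<infinity> then (MAX i\<in>{..<m}. \<bar>x i\<bar>)
     else (\<Sum>i<m. \<bar>x i\<bar> powr real_of_ereal q) powr (1 / real_of_ereal q))"

definition lq_dist :: "ereal \<Rightarrow> nat \<Rightarrow> (nat \<Rightarrow> real) \<Rightarrow> (nat \<Rightarrow> real) set \<Rightarrow> real"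
  where "lq_dist q m x E = (INF y\<in>E. lq_norm q m (\<lambda>i. x i - y i))"

definition lq_margin ::
    "ereal \<Rightarrow> nat \<Rightarrow> nat \<Rightarrow> (nat \<Rightarrow> real) set \<Rightarrow> (nat \<Rightarrow> real) set \<Rightarrow> (nat \<times> nat \<Rightarrow> real) \<Rightarrow> real"
  where "lq_margin q m n Q E A = (INF \<sigma>\<in>Q. lq_dist q m (mat_vec m n A \<sigma>) E)"

text \<open>The law of an \<open>m \<times> n\<close> random matrix with independent standard normal entries.\<close>

definition gaussian_matrix :: "nat \<Rightarrow> nat \<Rightarrow> (nat \<times> nat \<Rightarrow> real) measure"
  where "gaussian_matrix m n = Pi\<^sub>M ({..<m} \<times> {..<n}) (\<lambda>_. std_normal_distribution)"

lemma prob_space_gaussian_matrix: "prob_space (gaussian_matrix m n)"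
  unfolding gaussian_matrix_def
  by (intro prob_space_PiM prob_space_normal_density) simp

end

theory Submission
  imports Defs "HOL-Real_Asymp.Real_Asymp"
begin

text \<open>
  If a matrix \<open>A\<close> is moved by \<open>H\<close>, each \<open>A \<sigma>\<close> with \<open>\<sigma>\<close> in the unit ball moves in coordinate \<open>i\<close>
  by at most the length of row \<open>i\<close> of \<open>H\<close>; so the margin moves by at most the \<open>\<ell>\<^sup>q\<close> norm of
  the vector of row lengths of \<open>H\<close>. This has two consequences for the gradient of the margin.
  Since \<open>q \<ge> 2\<close>, its Euclidean length is at most \<open>1\<close>, which alone gives a bounded variance.
  And if all rows of \<open>H\<close> have length \<open>r\<close>, the margin moves by at most \<open>M\<^sup>1\<^sup>/\<^sup>q r\<close>, whereas the
  Euclidean bound only gives \<open>M\<^sup>1\<^sup>/\<^sup>2 r\<close>. As \<open>E\<close> is symmetric, all rows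
  have the same mean influence on the margin, and the second bound forces that influence to be at
  most \<open>M\<^sup>1\<^sup>/\<^sup>q\<^sup>-\<^sup>1\<close>, well below the value \<open>M\<^sup>-\<^sup>1\<^sup>/\<^sup>2\<close> that a gradient of length \<open>1\<close>
  spread evenly over the rows would suggest.

  Variables of small mean influence force a small variance. The inequality used is, for every
  \<open>\<tau> \<ge> 1\<close>,
  \<open>Var f (1 + ln \<tau>) \<le> 4 (\<Sum>a. \<mu>((\<partial>\<^sub>a f)\<^sup>2)) + \<tau> (\<Sum>a. (\<mu> \<bar>\<partial>\<^sub>a f\<bar>)\<^sup>2)\<close> with \<open>\<mu>\<close> the mean,
  an \<open>L\<^sup>1\<close>-\<open>L\<^sup>2\<close> inequality in the manner of Talagrand, proved as by Falik and Samorodnitsky: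
  split \<open>f\<close> into martingale differences \<open>d\<close>, and apply to each the logarithmic Sobolev inequality,
  which improves on the spectral gap by the logarithm of the ratio of \<open>\<mu>(d\<^sup>2)\<close> to \<open>(\<mu> \<bar>d\<bar>)\<^sup>2\<close>. With
  \<open>\<tau> = M\<^sup>1\<^sup>-\<^sup>2\<^sup>/\<^sup>q\<close> the right-hand side is at most \<open>4 + 1\<close>, whence the constant \<open>5\<close>.

  The inequality is established on the discrete cube (\<open>cube_variance_bound\<close>), where all averages
  are finite sums and a logarithmic Sobolev inequality with a sufficient constant follows by induction
  from an elementary two-point estimate (\<open>cube_log_Sobolev\<close>). It passes to Gaussian measure
  by writing each Gaussian entry as a limit of \<open>k\<^sup>-\<^sup>1\<^sup>/\<^sup>2\<close> times a sum of \<open>k\<close> random signs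
  (\<open>walk_CLT_product\<close>): one sign has an influence of order \<open>k\<^sup>-\<^sup>1\<^sup>/\<^sup>2\<close>, and as there are \<open>k\<close> of
  them for each entry, both sums of squares on the right survive in the limit
  (\<open>gaussian_variance_smooth\<close>). That step needs derivatives, so the
  margin is first clipped, averaged over short segments in each coordinate direction and then
  averaged over row permutations (\<open>clip_approximation\<close>); these operations keep all bounds on
  increments, and are undone by dominated convergence (\<open>gaussian_variance_row_symmetric\<close>).
\<close>

section \<open>Averages over the discrete cube\<close>

text \<open>
  A point of the cube is coded as the set of its coordinates that are switched on, so that the cube
  over \<open>B\<close> is \<open>Pow B\<close> and induction over finite sets adds one bit at a time.
\<close>

definition cube_avg :: "'b set \<Rightarrow> ('b set \<Rightarrow> real) \<Rightarrow> real"
  where "cube_avg B \<phi> = (\<Sum>S\<in>Pow B. \<phi> S) / 2 ^ card B"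

text \<open>
  Comparing the two settings of a bit, rather than the present one with its flip, makes the
  difference independent of that bit.
\<close>

definition bit_diff :: "'b \<Rightarrow> ('b set \<Rightarrow> real) \<Rightarrow> 'b set \<Rightarrow> real"
  where "bit_diff b \<phi> S = \<phi> (insert b S) - \<phi> (S - {b})"

lemma cube_avg_insert:
  assumes "finite B" "b \<notin> B"
  shows "cube_avg (insert b B) \<phi> = (cube_avg B \<phi> + cube_avg B (\<lambda>S. \<phi> (insert b S))) / 2"
proof -
  have "inj_on (insert b) (Pow B)"
    using assms(2) by (auto simp: inj_on_def)
  moreover have "Pow B \<inter> insert b ` Pow B = {}"
    using assms(2) by auto
  ultimately have "(\<Sum>S\<in>Pow (insert b B). \<phi> S)
      = (\<Sum>S\<in>Pow B. \<phi> S) + (\<Sum>S\<in>Pow B. \<phi> (insert b S))"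
    using assms(1) by (simp add: Pow_insert sum.union_disjoint sum.reindex)
  then show ?thesis
    using assms by (simp add: cube_avg_def add_divide_distrib)
qed

lemma cube_avg_cong: "(\<And>S. S \<subseteq> B \<Longrightarrow> \<phi> S = \<psi> S) \<Longrightarrow> cube_avg B \<phi> = cube_avg B \<psi>"
  by (simp add: cube_avg_def)

lemma cube_avg_mono: "(\<And>S. S \<subseteq> B \<Longrightarrow> \<phi> S \<le> \<psi> S) \<Longrightarrow> cube_avg B \<phi> \<le> cube_avg B \<psi>"
  unfolding cube_avg_def by (intro divide_right_mono sum_mono) auto

lemma cube_avg_const: "finite B \<Longrightarrow> cube_avg B (\<lambda>_. c) = c"
  by (simp add: cube_avg_def card_Pow)

lemma cube_avg_add: "cube_avg B (\<lambda>S. \<phi> S + \<psi> S) = cube_avg B \<phi> + cube_avg B \<psi>"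
  by (simp add: cube_avg_def sum.distrib add_divide_distrib)

lemma cube_avg_diff: "cube_avg B (\<lambda>S. \<phi> S - \<psi> S) = cube_avg B \<phi> - cube_avg B \<psi>"
  by (simp add: cube_avg_def sum_subtractf diff_divide_distrib)

lemma cube_avg_cmult: "cube_avg B (\<lambda>S. c * \<phi> S) = c * cube_avg B \<phi>"
  by (simp add: cube_avg_def sum_distrib_left)

lemma cube_avg_sum: "cube_avg B (\<lambda>S. \<Sum>a\<in>A. \<phi> a S) = (\<Sum>a\<in>A. cube_avg B (\<phi> a))"
  by (simp add: cube_avg_def sum.swap[of _ A] sum_divide_distrib)

lemma cube_avg_nonneg: "(\<And>S. S \<subseteq> B \<Longrightarrow> 0 \<le> \<phi> S) \<Longrightarrow> 0 \<le> cube_avg B \<phi>"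
  by (auto simp: cube_avg_def intro!: divide_nonneg_pos sum_nonneg)

lemma cube_avg_Cauchy_Schwarz:
  "cube_avg B (\<lambda>S. \<phi> S * \<psi> S) \<le> sqrt (cube_avg B (\<lambda>S. (\<phi> S)\<^sup>2)) * sqrt (cube_avg B (\<lambda>S. (\<psi> S)\<^sup>2))"
proof -
  have "(\<Sum>S\<in>Pow B. \<phi> S * \<psi> S) \<le> (\<Sum>S\<in>Pow B. \<bar>\<phi> S\<bar> * \<bar>\<psi> S\<bar>)"
    by (intro sum_mono) (simp flip: abs_mult)
  also have "\<dots> \<le> L2_set \<phi> (Pow B) * L2_set \<psi> (Pow B)"
    by (rule L2_set_mult_ineq)
  finally have "(\<Sum>S\<in>Pow B. \<phi> S * \<psi> S) / 2 ^ card B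
      \<le> (L2_set \<phi> (Pow B) * L2_set \<psi> (Pow B)) / 2 ^ card B"
    by (rule divide_right_mono) simp
  then show ?thesis
    by (simp add: cube_avg_def L2_set_def real_sqrt_divide)
qed

section \<open>A variance bound on the cube\<close>

text \<open>
  The entropy of a nonnegative variable is at most its variance divided by its mean \<open>m\<close>, by the tangent
  inequality \<open>ln y \<le> y - 1\<close>. For \<open>a\<^sup>2\<close> and \<open>b\<^sup>2\<close> that quotient is
  \<open>(a - b)\<^sup>2 (a + b)\<^sup>2 / (4 m)\<close>, and \<open>(a + b)\<^sup>2 \<le> 4 m\<close>. The optimal constant is smaller by
  a factor \<open>2\<close>, which would only improve the final constant.
\<close>

lemma two_point_log_Sobolev:
  fixes a b :: real
  assumes "0 \<le> a" "0 \<le> b"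
  shows "(a\<^sup>2 * ln (a\<^sup>2) + b\<^sup>2 * ln (b\<^sup>2)) / 2 - (a\<^sup>2 + b\<^sup>2) / 2 * ln ((a\<^sup>2 + b\<^sup>2) / 2) \<le> (a - b)\<^sup>2"
proof (cases "a = 0 \<and> b = 0")
  case False
  define m where "m = (a\<^sup>2 + b\<^sup>2) / 2"
  have m: "m > 0" using False by (auto simp: m_def sum_power2_gt_zero_iff)
  have tangent: "x * ln x \<le> x * ln m + x * (x / m - 1)" if "0 \<le> x" for x
  proof (cases "x = 0")
    case False
    then have "ln (x / m) \<le> x / m - 1"
      using that m by (intro ln_le_minus_one) auto
    then have "ln x \<le> ln m + (x / m - 1)"
      using that m False by (simp add: ln_div)
    then show ?thesis
      using that by (metis distrib_left mult_left_mono)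
  qed simp
  have "(a\<^sup>2 * ln (a\<^sup>2) + b\<^sup>2 * ln (b\<^sup>2)) / 2 - m * ln m
      \<le> (a\<^sup>2 * (a\<^sup>2 / m - 1) + b\<^sup>2 * (b\<^sup>2 / m - 1)) / 2"
    using tangent[of "a\<^sup>2"] tangent[of "b\<^sup>2"] by (simp add: m_def field_simps)
  also have "\<dots> = (a\<^sup>2 - b\<^sup>2)\<^sup>2 / (4 * m)"
  proof -
    have b: "b\<^sup>2 = 2 * m - a\<^sup>2" by (simp add: m_def field_simps)
    show ?thesis
      unfolding b using m by (simp add: field_simps power2_eq_square)
  qed
  also have "\<dots> = (a - b)\<^sup>2 * ((a + b)\<^sup>2 / (4 * m))"
    by (simp add: field_simps power2_eq_square)
  also have "\<dots> \<le> (a - b)\<^sup>2 * 1"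
  proof (rule mult_left_mono)
    have "(a + b)\<^sup>2 + (a - b)\<^sup>2 = 4 * m" by (simp add: m_def power2_eq_square algebra_simps)
    then have "(a + b)\<^sup>2 \<le> 4 * m" using zero_le_power2[of "a - b"] by linarith
    then show "(a + b)\<^sup>2 / (4 * m) \<le> 1" using m by (simp add: field_simps)
  qed simp
  finally show ?thesis by (simp add: m_def)
qed auto

text \<open>
  Adding a bit splits the entropy into the mean entropy of the two halves and the entropy of the pair
  of their second moments \<open>m0\<close>, \<open>m1\<close>. The two-point inequality bounds the latter by
  \<open>(sqrt m1 - sqrt m0)\<^sup>2\<close>, which is at most the mean square of the difference of the halves by the reverse
  triangle inequality in \<open>L\<^sup>2\<close>.
\<close>

lemma cube_log_Sobolev:
  assumes "finite B"
  shows "cube_avg B (\<lambda>S. (\<phi> S)\<^sup>2 * ln ((\<phi> S)\<^sup>2))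
      - cube_avg B (\<lambda>S. (\<phi> S)\<^sup>2) * ln (cube_avg B (\<lambda>S. (\<phi> S)\<^sup>2))
    \<le> (\<Sum>b\<in>B. cube_avg B (\<lambda>S. (bit_diff b \<phi> S)\<^sup>2))"
  using assms
proof (induction B arbitrary: \<phi> rule: finite_induct)
  case (insert b B)
  define \<phi>1 where "\<phi>1 S = \<phi> (insert b S)" for S
  define m0 m1 where "m0 = cube_avg B (\<lambda>S. (\<phi> S)\<^sup>2)" and "m1 = cube_avg B (\<lambda>S. (\<phi>1 S)\<^sup>2)"
  have m_nonneg: "0 \<le> m0" "0 \<le> m1" by (auto simp: m0_def m1_def intro!: cube_avg_nonneg)
  have old_bits: "cube_avg (insert b B) (\<lambda>S. (bit_diff c \<phi> S)\<^sup>2)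
      = (cube_avg B (\<lambda>S. (bit_diff c \<phi> S)\<^sup>2) + cube_avg B (\<lambda>S. (bit_diff c \<phi>1 S)\<^sup>2)) / 2"
    if "c \<in> B" for c
  proof -
    have "bit_diff c \<phi> (insert b S) = bit_diff c \<phi>1 S" for S
      using that insert.hyps
      by (metis bit_diff_def \<phi>1_def insert_Diff_if insert_commute singletonD)
    then show ?thesis
      using insert.hyps by (simp add: cube_avg_insert)
  qed
  have new_bit: "cube_avg (insert b B) (\<lambda>S. (bit_diff b \<phi> S)\<^sup>2) = cube_avg B (\<lambda>S. (\<phi>1 S - \<phi> S)\<^sup>2)"
  proof -
    have "S - {b} = S" "insert b S - {b} = S" if "S \<subseteq> B" for S
      using that insert.hyps(2) by auto
    then have "cube_avg B (\<lambda>S. (bit_diff b \<phi> S)\<^sup>2) = cube_avg B (\<lambda>S. (\<phi>1 S - \<phi> S)\<^sup>2)"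
      "cube_avg B (\<lambda>S. (bit_diff b \<phi> (insert b S))\<^sup>2) = cube_avg B (\<lambda>S. (\<phi>1 S - \<phi> S)\<^sup>2)"
      by (simp_all add: bit_diff_def \<phi>1_def cong: cube_avg_cong)
    then show ?thesis
      using insert.hyps by (simp add: cube_avg_insert)
  qed
  have "(sqrt m1 - sqrt m0)\<^sup>2 \<le> cube_avg B (\<lambda>S. (\<phi>1 S - \<phi> S)\<^sup>2)"
  proof -
    have "cube_avg B (\<lambda>S. (\<phi>1 S - \<phi> S)\<^sup>2) = m1 + m0 - 2 * cube_avg B (\<lambda>S. \<phi>1 S * \<phi> S)"
      by (simp add: m0_def m1_def power2_diff cube_avg_add cube_avg_diff cube_avg_cmult mult.assoc)
    moreover have "cube_avg B (\<lambda>S. \<phi>1 S * \<phi> S) \<le> sqrt m1 * sqrt m0"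
      unfolding m0_def m1_def by (rule cube_avg_Cauchy_Schwarz)
    ultimately show ?thesis
      using m_nonneg by (simp add: power2_diff)
  qed
  moreover have "(m1 * ln m1 + m0 * ln m0) / 2 - (m1 + m0) / 2 * ln ((m1 + m0) / 2)
      \<le> (sqrt m1 - sqrt m0)\<^sup>2"
    using two_point_log_Sobolev[of "sqrt m1" "sqrt m0"] m_nonneg by simp
  moreover have "cube_avg (insert b B) (\<lambda>S. (\<phi> S)\<^sup>2) = (m1 + m0) / 2"
    using insert.hyps by (simp add: cube_avg_insert m0_def m1_def \<phi>1_def)
  moreover define e0 e1 where "e0 = cube_avg B (\<lambda>S. (\<phi> S)\<^sup>2 * ln ((\<phi> S)\<^sup>2))"
    and "e1 = cube_avg B (\<lambda>S. (\<phi>1 S)\<^sup>2 * ln ((\<phi>1 S)\<^sup>2))"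
  then have "cube_avg (insert b B) (\<lambda>S. (\<phi> S)\<^sup>2 * ln ((\<phi> S)\<^sup>2)) = (e1 + e0) / 2"
    using insert.hyps by (simp add: cube_avg_insert e0_def e1_def \<phi>1_def)
  moreover have "e0 - m0 * ln m0 \<le> (\<Sum>c\<in>B. cube_avg B (\<lambda>S. (bit_diff c \<phi> S)\<^sup>2))"
    "e1 - m1 * ln m1 \<le> (\<Sum>c\<in>B. cube_avg B (\<lambda>S. (bit_diff c \<phi>1 S)\<^sup>2))"
    using insert.IH[of \<phi>] insert.IH[of \<phi>1] by (simp_all add: e0_def e1_def m0_def m1_def)
  moreover have "(\<Sum>c\<in>insert b B. cube_avg (insert b B) (\<lambda>S. (bit_diff c \<phi> S)\<^sup>2))
      = cube_avg B (\<lambda>S. (\<phi>1 S - \<phi> S)\<^sup>2) + ((\<Sum>c\<in>B. cube_avg B (\<lambda>S. (bit_diff c \<phi> S)\<^sup>2))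
        + (\<Sum>c\<in>B. cube_avg B (\<lambda>S. (bit_diff c \<phi>1 S)\<^sup>2))) / 2"
    using insert.hyps by (simp add: new_bit old_bits sum.distrib flip: sum_divide_distrib)
  moreover have "(e1 + e0) / 2 - L \<le> u + (A0 + A1) / 2"
    if "w \<le> u" "(P1 + P0) / 2 - L \<le> w" "e0 - P0 \<le> A0" "e1 - P1 \<le> A1"
    for L P0 P1 w u A0 A1 :: real
    using that by argo
  ultimately show ?case
    by (simp only:)
qed (simp add: cube_avg_def)

text \<open>
  The entropy of \<open>\<phi>\<^sup>2\<close> is at least \<open>n2 ln (n2 / n1\<^sup>2)\<close>, where \<open>n1\<close> and \<open>n2\<close> are the means of
  \<open>\<bar>\<phi>\<bar>\<close> and \<open>\<phi>\<^sup>2\<close>. Replacing the logarithm by its tangent with parameter \<open>\<tau>\<close> gives an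
  inequality that can be summed over martingale differences without any convexity argument.
\<close>

lemma cube_log_Sobolev_linearised:
  assumes "finite B" "0 < \<tau>"
  shows "cube_avg B (\<lambda>S. (\<phi> S)\<^sup>2) * (1 + ln \<tau>)
    \<le> (\<Sum>b\<in>B. cube_avg B (\<lambda>S. (bit_diff b \<phi> S)\<^sup>2)) + \<tau> * (cube_avg B (\<lambda>S. \<bar>\<phi> S\<bar>))\<^sup>2"
proof -
  define n1 n2 where "n1 = cube_avg B (\<lambda>S. \<bar>\<phi> S\<bar>)" and "n2 = cube_avg B (\<lambda>S. (\<phi> S)\<^sup>2)"
  have n1: "0 \<le> n1" unfolding n1_def by (intro cube_avg_nonneg) simp
  have energy: "0 \<le> (\<Sum>b\<in>B. cube_avg B (\<lambda>S. (bit_diff b \<phi> S)\<^sup>2))"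
    by (intro sum_nonneg cube_avg_nonneg) simp
  show ?thesis
  proof (cases "n1 = 0 \<or> n2 \<le> 0")
    case True
    have "\<phi> S = 0" if "n1 = 0" "S \<subseteq> B" for S
    proof -
      have "(\<Sum>S\<in>Pow B. \<bar>\<phi> S\<bar>) = 0" using that by (simp add: n1_def cube_avg_def)
      then show ?thesis using that assms(1) by (subst (asm) sum_nonneg_eq_0_iff) auto
    qed
    then have "n1 = 0 \<Longrightarrow> n2 = 0" by (simp add: n2_def cube_avg_def)
    moreover have "0 \<le> n2" unfolding n2_def by (intro cube_avg_nonneg) simp
    ultimately have "n2 = 0" using True by auto
    then show ?thesis using energy assms by (simp add: n2_def)
  next
    case False
    then have pos: "n1 > 0" "n2 > 0" using n1 by auto
    \<comment> \<open>The value of \<open>c\<close> that maximises \<open>n2 ln (c\<^sup>2) + 2 n2 - 2 c n1\<close>.\<close>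
    define c where "c = n2 / n1"
    have c: "c > 0" using pos by (simp add: c_def)
    have pointwise: "ln (c\<^sup>2) * (\<phi> S)\<^sup>2 + 2 * (\<phi> S)\<^sup>2 - (2 * c) * \<bar>\<phi> S\<bar> \<le> (\<phi> S)\<^sup>2 * ln ((\<phi> S)\<^sup>2)" for S
    proof (cases "\<phi> S = 0")
      case False
      have "ln (c / \<bar>\<phi> S\<bar>) \<le> c / \<bar>\<phi> S\<bar> - 1"
        using c False by (intro ln_le_minus_one) auto
      then have "ln c + 1 - c / \<bar>\<phi> S\<bar> \<le> ln \<bar>\<phi> S\<bar>" using c False by (simp add: ln_div)
      then have "(\<phi> S)\<^sup>2 * (ln c + 1 - c / \<bar>\<phi> S\<bar>) \<le> (\<phi> S)\<^sup>2 * ln \<bar>\<phi> S\<bar>"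
        by (intro mult_left_mono) auto
      moreover have "(\<phi> S)\<^sup>2 * (c / \<bar>\<phi> S\<bar>) = c * \<bar>\<phi> S\<bar>"
        using False by (simp add: power2_eq_square abs_if)
      moreover have "ln ((\<phi> S)\<^sup>2) = 2 * ln \<bar>\<phi> S\<bar>" "ln (c\<^sup>2) = 2 * ln c"
        using c False ln_realpow[of "\<bar>\<phi> S\<bar>" 2] ln_realpow[of c 2] by auto
      ultimately show ?thesis by (simp add: algebra_simps)
    qed simp
    have "n2 * ln (c\<^sup>2) = ln (c\<^sup>2) * n2 + 2 * n2 - (2 * c) * n1"
      using pos by (simp add: c_def)
    also have "\<dots> = cube_avg B (\<lambda>S. ln (c\<^sup>2) * (\<phi> S)\<^sup>2 + 2 * (\<phi> S)\<^sup>2 - (2 * c) * \<bar>\<phi> S\<bar>)"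
      by (simp only: cube_avg_add cube_avg_diff cube_avg_cmult n1_def n2_def)
    also have "\<dots> \<le> cube_avg B (\<lambda>S. (\<phi> S)\<^sup>2 * ln ((\<phi> S)\<^sup>2))"
      by (intro cube_avg_mono pointwise)
    finally have "n2 * ln (c\<^sup>2) - n2 * ln n2 \<le> (\<Sum>b\<in>B. cube_avg B (\<lambda>S. (bit_diff b \<phi> S)\<^sup>2))"
      using cube_log_Sobolev[OF assms(1), of \<phi>] by (simp flip: n2_def)
    moreover have "n2 * (1 + ln \<tau>) - \<tau> * n1\<^sup>2 \<le> n2 * ln (c\<^sup>2) - n2 * ln n2"
    proof -
      have "ln (\<tau> * n1\<^sup>2 / n2) \<le> \<tau> * n1\<^sup>2 / n2 - 1"
        using pos assms by (intro ln_le_minus_one) auto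
      moreover have "ln (\<tau> * n1\<^sup>2 / n2) = ln \<tau> - ln (c\<^sup>2) + ln n2"
        using pos assms by (simp add: c_def ln_div ln_mult ln_realpow)
      ultimately have "n2 * (ln \<tau> - ln (c\<^sup>2) + ln n2) \<le> n2 * (\<tau> * n1\<^sup>2 / n2 - 1)"
        using pos by (intro mult_left_mono) auto
      then show ?thesis using pos by (simp add: algebra_simps)
    qed
    ultimately show ?thesis by (simp flip: n1_def n2_def)
  qed
qed

text \<open>
  On the two halves of the cube given by a new bit, \<open>\<phi>\<close> equals \<open>m - d\<close> and \<open>m + d\<close>. So the variance is
  that of \<open>m\<close>, handled by induction, plus the second moment of \<open>d\<close>, handled by the
  logarithmic Sobolev inequality; iterated, this is the decomposition of \<open>\<phi>\<close> into martingale
  differences. The energies in the old bits add up exactly, since the difference of \<open>\<phi>\<close> in an old bit is that of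
  \<open>m\<close> plus or minus that of \<open>d\<close>, and the mean of \<open>\<bar>d\<bar>\<close> is half the mean influence of the new bit.
\<close>

lemma cube_variance_bound:
  assumes "finite B" "1 \<le> \<tau>"
  shows "(cube_avg B (\<lambda>S. (\<phi> S)\<^sup>2) - (cube_avg B \<phi>)\<^sup>2) * (1 + ln \<tau>)
    \<le> (\<Sum>b\<in>B. cube_avg B (\<lambda>S. (bit_diff b \<phi> S)\<^sup>2))
      + \<tau> * (\<Sum>b\<in>B. (cube_avg B (\<lambda>S. \<bar>bit_diff b \<phi> S\<bar>) / 2)\<^sup>2)"
  using assms(1)
proof (induction B arbitrary: \<phi> rule: finite_induct)
  case (insert b B)
  define m where "m S = (\<phi> (insert b S) + \<phi> S) / 2" for S
  define d where "d S = (\<phi> (insert b S) - \<phi> S) / 2" for S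
  have \<phi>_insert: "\<phi> (insert b S) = m S + d S" for S
    by (simp add: m_def d_def field_simps)
  have \<phi>_avg: "cube_avg (insert b B) (\<lambda>S. F (\<phi> S)) = (cube_avg B (\<lambda>S. F (m S - d S)) + cube_avg B (\<lambda>S. F (m S + d S))) / 2"
    for F :: "real \<Rightarrow> real"
  proof -
    have "F (m S - d S) = F (\<phi> S)" for S by (simp add: m_def d_def field_simps)
    then show ?thesis
      using insert.hyps by (simp add: cube_avg_insert \<phi>_insert)
  qed
  have mean: "cube_avg (insert b B) \<phi> = cube_avg B m"
    using \<phi>_avg[of "\<lambda>x. x"] by (simp add: cube_avg_add cube_avg_diff)
  have second: "cube_avg (insert b B) (\<lambda>S. (\<phi> S)\<^sup>2) = cube_avg B (\<lambda>S. (m S)\<^sup>2) + cube_avg B (\<lambda>S. (d S)\<^sup>2)"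
    using \<phi>_avg[of "\<lambda>x. x\<^sup>2"]
    by (simp add: power2_sum power2_diff cube_avg_add cube_avg_diff)
  have diff: "cube_avg (insert b B) (\<lambda>S. F (bit_diff c \<phi> S))
      = (cube_avg B (\<lambda>S. F (bit_diff c m S - bit_diff c d S))
        + cube_avg B (\<lambda>S. F (bit_diff c m S + bit_diff c d S))) / 2"
    if "c \<in> B" for c and F :: "real \<Rightarrow> real"
  proof -
    have "insert c (insert b S) = insert b (insert c S)" "insert b S - {c} = insert b (S - {c})" for S
      using that insert.hyps by auto
    then have "bit_diff c \<phi> S = bit_diff c m S - bit_diff c d S"
      "bit_diff c \<phi> (insert b S) = bit_diff c m S + bit_diff c d S" for S
      by (simp_all add: bit_diff_def m_def d_def field_simps)
    then show ?thesis
      using insert.hyps by (simp add: cube_avg_insert)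
  qed
  have energy: "cube_avg (insert b B) (\<lambda>S. (bit_diff c \<phi> S)\<^sup>2)
      = cube_avg B (\<lambda>S. (bit_diff c m S)\<^sup>2) + cube_avg B (\<lambda>S. (bit_diff c d S)\<^sup>2)" if "c \<in> B" for c
    using diff[OF that, of "\<lambda>x. x\<^sup>2"]
    by (simp add: power2_sum power2_diff cube_avg_add cube_avg_diff)
  have influence: "(cube_avg B (\<lambda>S. \<bar>bit_diff c m S\<bar>) / 2)\<^sup>2
      \<le> (cube_avg (insert b B) (\<lambda>S. \<bar>bit_diff c \<phi> S\<bar>) / 2)\<^sup>2" if "c \<in> B" for c
  proof -
    have "cube_avg B (\<lambda>S. 2 * \<bar>bit_diff c m S\<bar>)
        \<le> cube_avg B (\<lambda>S. \<bar>bit_diff c m S - bit_diff c d S\<bar> + \<bar>bit_diff c m S + bit_diff c d S\<bar>)"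
      by (intro cube_avg_mono) linarith
    then have "cube_avg B (\<lambda>S. \<bar>bit_diff c m S\<bar>) \<le> cube_avg (insert b B) (\<lambda>S. \<bar>bit_diff c \<phi> S\<bar>)"
      using diff[OF that, of abs] by (simp add: cube_avg_add cube_avg_cmult)
    then show ?thesis
      by (intro power_mono divide_right_mono divide_nonneg_pos cube_avg_nonneg) auto
  qed
  have new_bit: "cube_avg (insert b B) (\<lambda>S. \<bar>bit_diff b \<phi> S\<bar>) / 2 = cube_avg B (\<lambda>S. \<bar>d S\<bar>)"
  proof -
    have "\<bar>bit_diff b \<phi> S\<bar> = 2 * \<bar>d S\<bar>" "\<bar>bit_diff b \<phi> (insert b S)\<bar> = 2 * \<bar>d S\<bar>" if "S \<subseteq> B" for S
    proof -
      have "S - {b} = S" "insert b S - {b} = S" using that insert.hyps by auto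
      then show "\<bar>bit_diff b \<phi> S\<bar> = 2 * \<bar>d S\<bar>" "\<bar>bit_diff b \<phi> (insert b S)\<bar> = 2 * \<bar>d S\<bar>"
        by (simp_all add: bit_diff_def d_def)
    qed
    then have "cube_avg (insert b B) (\<lambda>S. \<bar>bit_diff b \<phi> S\<bar>) = cube_avg B (\<lambda>S. 2 * \<bar>d S\<bar>)"
      using insert.hyps by (simp add: cube_avg_insert cong: cube_avg_cong)
    then show ?thesis by (simp add: cube_avg_cmult)
  qed
  have "(cube_avg (insert b B) (\<lambda>S. (\<phi> S)\<^sup>2) - (cube_avg (insert b B) \<phi>)\<^sup>2) * (1 + ln \<tau>)
      = (cube_avg B (\<lambda>S. (m S)\<^sup>2) - (cube_avg B m)\<^sup>2) * (1 + ln \<tau>)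
        + cube_avg B (\<lambda>S. (d S)\<^sup>2) * (1 + ln \<tau>)"
    by (simp add: mean second algebra_simps)
  also have "\<dots> \<le> ((\<Sum>c\<in>B. cube_avg B (\<lambda>S. (bit_diff c m S)\<^sup>2))
        + \<tau> * (\<Sum>c\<in>B. (cube_avg B (\<lambda>S. \<bar>bit_diff c m S\<bar>) / 2)\<^sup>2))
      + ((\<Sum>c\<in>B. cube_avg B (\<lambda>S. (bit_diff c d S)\<^sup>2)) + \<tau> * (cube_avg B (\<lambda>S. \<bar>d S\<bar>))\<^sup>2)"
    using insert.IH[of m] cube_log_Sobolev_linearised[OF insert.hyps(1), of \<tau> d] \<open>1 \<le> \<tau>\<close>
    by (intro add_mono) auto
  also have "\<dots> = (\<Sum>c\<in>B. cube_avg (insert b B) (\<lambda>S. (bit_diff c \<phi> S)\<^sup>2))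
      + \<tau> * ((\<Sum>c\<in>B. (cube_avg B (\<lambda>S. \<bar>bit_diff c m S\<bar>) / 2)\<^sup>2)
        + (cube_avg (insert b B) (\<lambda>S. \<bar>bit_diff b \<phi> S\<bar>) / 2)\<^sup>2)"
    by (simp only: new_bit) (simp add: energy sum.distrib algebra_simps)
  also have "\<dots> \<le> (\<Sum>c\<in>insert b B. cube_avg (insert b B) (\<lambda>S. (bit_diff c \<phi> S)\<^sup>2))
      + \<tau> * (\<Sum>c\<in>insert b B. (cube_avg (insert b B) (\<lambda>S. \<bar>bit_diff c \<phi> S\<bar>) / 2)\<^sup>2)"
  proof (intro add_mono mult_left_mono)
    have "0 \<le> cube_avg (insert b B) (\<lambda>S. (bit_diff b \<phi> S)\<^sup>2)"
      by (intro cube_avg_nonneg) simp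
    then show "(\<Sum>c\<in>B. cube_avg (insert b B) (\<lambda>S. (bit_diff c \<phi> S)\<^sup>2))
        \<le> (\<Sum>c\<in>insert b B. cube_avg (insert b B) (\<lambda>S. (bit_diff c \<phi> S)\<^sup>2))"
      using insert.hyps by simp
    show "(\<Sum>c\<in>B. (cube_avg B (\<lambda>S. \<bar>bit_diff c m S\<bar>) / 2)\<^sup>2)
        + (cube_avg (insert b B) (\<lambda>S. \<bar>bit_diff b \<phi> S\<bar>) / 2)\<^sup>2
        \<le> (\<Sum>c\<in>insert b B. (cube_avg (insert b B) (\<lambda>S. \<bar>bit_diff c \<phi> S\<bar>) / 2)\<^sup>2)"
      using insert.hyps sum_mono[OF influence, of B] by simp
  qed (use \<open>1 \<le> \<tau>\<close> in simp)
  finally show ?case .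
qed (simp add: cube_avg_def)

section \<open>Functions with a gradient\<close>

definition shift :: "'a \<Rightarrow> real \<Rightarrow> ('a \<Rightarrow> real) \<Rightarrow> 'a \<Rightarrow> real"
  where "shift a t x = x(a := x a + t)"

definition l1_lipschitz :: "'a set \<Rightarrow> real \<Rightarrow> (('a \<Rightarrow> real) \<Rightarrow> real) \<Rightarrow> bool"
  where "l1_lipschitz I K f \<longleftrightarrow> (\<forall>x y. \<bar>f x - f y\<bar> \<le> K * (\<Sum>b\<in>I. \<bar>x b - y b\<bar>))"

text \<open>
  A quantitative form of having a Lipschitz gradient: \<open>g a\<close> is the partial derivative of \<open>f\<close> in
  direction \<open>a\<close>, for \<open>a \<in> J\<close>, with an error that is quadratic uniformly in the base point. Inequalities
  of this kind, unlike derivatives, pass through averages without further argument.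
\<close>

definition has_gradient_on ::
    "'a set \<Rightarrow> 'a set \<Rightarrow> real \<Rightarrow> (('a \<Rightarrow> real) \<Rightarrow> real) \<Rightarrow> ('a \<Rightarrow> ('a \<Rightarrow> real) \<Rightarrow> real) \<Rightarrow> bool"
  where "has_gradient_on I J K f g \<longleftrightarrow> 0 \<le> K \<and>
    (\<forall>a\<in>J. l1_lipschitz I K (g a) \<and> (\<forall>x t. \<bar>f (shift a t x) - f x - t * g a x\<bar> \<le> K * t\<^sup>2))"

lemma l1_lipschitz_cong:
  assumes "l1_lipschitz I K G" "\<And>a. a \<in> I \<Longrightarrow> x a = y a"
  shows "G x = G y"
proof -
  have "\<bar>G x - G y\<bar> \<le> K * (\<Sum>b\<in>I. \<bar>x b - y b\<bar>)" using assms(1) by (simp add: l1_lipschitz_def)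
  also have "\<dots> = 0" using assms(2) by simp
  finally show ?thesis by simp
qed

lemma l1_lipschitz_tendsto:
  assumes "l1_lipschitz I K G" "\<And>a. a \<in> I \<Longrightarrow> ((\<lambda>n. x n a) \<longlongrightarrow> y a) F"
  shows "((\<lambda>n. G (x n)) \<longlongrightarrow> G y) F"
proof -
  have "((\<lambda>n. K * (\<Sum>b\<in>I. \<bar>x n b - y b\<bar>)) \<longlongrightarrow> K * (\<Sum>b\<in>I. \<bar>y b - y b\<bar>)) F"
    by (intro tendsto_mult_left tendsto_sum tendsto_rabs tendsto_diff tendsto_const assms(2))
  then have "((\<lambda>n. K * (\<Sum>b\<in>I. \<bar>x n b - y b\<bar>)) \<longlongrightarrow> 0) F" by simp
  moreover have "norm (G (x n) - G y) \<le> K * (\<Sum>b\<in>I. \<bar>x n b - y b\<bar>)" for n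
    using assms(1) unfolding l1_lipschitz_def real_norm_def by blast
  ultimately have "((\<lambda>n. G (x n) - G y) \<longlongrightarrow> 0) F"
    by (rule Lim_null_comparison[OF always_eventually[OF allI], rotated])
  then show ?thesis by (simp add: LIM_zero_iff)
qed

lemma sum_abs_shift:
  assumes "finite I" "a \<in> I"
  shows "(\<Sum>b\<in>I. \<bar>shift a u x b - shift a v x b\<bar>) = \<bar>u - v\<bar>"
proof -
  have "(\<Sum>b\<in>I. \<bar>shift a u x b - shift a v x b\<bar>) = (\<Sum>b\<in>I. if b = a then \<bar>u - v\<bar> else 0)"
    by (intro sum.cong) (auto simp: shift_def)
  then show ?thesis using assms by simp
qed

lemma l1_lipschitz_shift:
  assumes "finite I" "a \<in> I" "l1_lipschitz I K f"
  shows "\<bar>f (shift a u x) - f (shift a v x)\<bar> \<le> K * \<bar>u - v\<bar>"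
  using assms sum_abs_shift unfolding l1_lipschitz_def by metis

lemma continuous_on_shift:
  assumes "finite I" "a \<in> I" "l1_lipschitz I K f"
  shows "continuous_on T (\<lambda>u. f (shift a u x))"
proof -
  have "\<bar>K\<bar>-lipschitz_on T (\<lambda>u. f (shift a u x))"
  proof (intro lipschitz_onI)
    fix u v
    have "\<bar>f (shift a u x) - f (shift a v x)\<bar> \<le> K * \<bar>u - v\<bar>"
      by (rule l1_lipschitz_shift[OF assms])
    also have "\<dots> \<le> \<bar>K\<bar> * \<bar>u - v\<bar>" by (intro mult_right_mono) auto
    finally show "dist (f (shift a u x)) (f (shift a v x)) \<le> \<bar>K\<bar> * dist u v"
      by (simp add: dist_real_def)
  qed simp
  then show ?thesis by (rule lipschitz_on_continuous_on)
qed

text \<open>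
  The move by \<open>t H\<close> is made one coordinate at a time; as the gradient is Lipschitz, the total error is
  quadratic in \<open>t\<close>. In this way the gradient inherits every bound on the increments of \<open>f\<close>.
\<close>

lemma gradient_pairing_le:
  assumes I: "finite I" and f: "l1_lipschitz I L f" and g: "has_gradient_on I I K f g"
    and incr: "\<And>t. 0 < t \<Longrightarrow> \<bar>f (\<lambda>a. x a + t * H a) - f x\<bar> \<le> t * c"
  shows "(\<Sum>a\<in>I. H a * g a x) \<le> c"
proof -
  define move where "move J t = (\<lambda>i. x i + (if i \<in> J then t * H i else 0))" for J t
  have K: "0 \<le> K" using g by (simp add: has_gradient_on_def)
  have "\<exists>K'. \<forall>t\<ge>0. \<bar>f (move J t) - f x - t * (\<Sum>a\<in>J. H a * g a x)\<bar> \<le> K' * t\<^sup>2"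
    if "finite J" "J \<subseteq> I" for J
    using that
  proof (induction J rule: finite_induct)
    case empty
    then show ?case by (intro exI[of _ 0]) (simp add: move_def)
  next
    case (insert a J)
    then obtain K' where K': "\<And>t. 0 \<le> t \<Longrightarrow> \<bar>f (move J t) - f x - t * (\<Sum>a\<in>J. H a * g a x)\<bar> \<le> K' * t\<^sup>2"
      by auto
    define s where "s = (\<Sum>b\<in>I. \<bar>H b\<bar>)"
    have "\<bar>f (move (insert a J) t) - f x - t * (\<Sum>a\<in>insert a J. H a * g a x)\<bar>
        \<le> (K' + K * (H a)\<^sup>2 + \<bar>H a\<bar> * (K * s)) * t\<^sup>2" if "0 \<le> t" for t
    proof -
      have a: "a \<in> I" using insert by simp
      have "move (insert a J) t = shift a (t * H a) (move J t)"
        using insert.hyps by (auto simp: move_def shift_def)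
      then have 1: "\<bar>f (move (insert a J) t) - f (move J t) - t * H a * g a (move J t)\<bar> \<le> K * (t * H a)\<^sup>2"
        using g a by (simp add: has_gradient_on_def)
      have "\<bar>g a (move J t) - g a x\<bar> \<le> K * (\<Sum>b\<in>I. \<bar>move J t b - x b\<bar>)"
        using g a unfolding has_gradient_on_def l1_lipschitz_def by blast
      also have "\<dots> \<le> K * (\<Sum>b\<in>I. t * \<bar>H b\<bar>)"
        using K that by (intro mult_left_mono sum_mono) (auto simp: move_def abs_mult)
      finally have "\<bar>g a (move J t) - g a x\<bar> \<le> K * (t * s)"
        by (simp add: s_def sum_distrib_left)
      then have "\<bar>t * H a\<bar> * \<bar>g a (move J t) - g a x\<bar> \<le> \<bar>t * H a\<bar> * (K * (t * s))"
        by (intro mult_left_mono) auto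
      then have 2: "\<bar>t * H a * g a (move J t) - t * H a * g a x\<bar> \<le> \<bar>H a\<bar> * (K * s) * t\<^sup>2"
        using that by (simp add: abs_mult right_diff_distrib[symmetric] power2_eq_square mult_ac)
      have "t * (\<Sum>a\<in>insert a J. H a * g a x) = t * (\<Sum>a\<in>J. H a * g a x) + t * H a * g a x"
        using insert.hyps by (simp add: algebra_simps)
      moreover have "K * (t * H a)\<^sup>2 = K * (H a)\<^sup>2 * t\<^sup>2" by (simp add: power_mult_distrib)
      ultimately show ?thesis
        using 1 2 K'[OF that] by (simp only: distrib_right)
    qed
    then show ?case by blast
  qed
  from this[OF I order_refl] obtain K'
    where K': "\<And>t. 0 \<le> t \<Longrightarrow> \<bar>f (move I t) - f x - t * (\<Sum>a\<in>I. H a * g a x)\<bar> \<le> K' * t\<^sup>2"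
    by blast
  have "(\<Sum>a\<in>I. H a * g a x) \<le> c + K' * t" if "0 < t" for t
  proof -
    have "f (move I t) = f (\<lambda>a. x a + t * H a)"
      by (rule l1_lipschitz_cong[OF f]) (simp add: move_def)
    then have "t * (\<Sum>a\<in>I. H a * g a x) \<le> t * (c + K' * t)"
      using K'[of t] incr[OF that] that by (simp add: distrib_left power2_eq_square mult_ac)
    then show ?thesis using that by simp
  qed
  then have "eventually (\<lambda>t. (\<Sum>a\<in>I. H a * g a x) \<le> c + K' * t) (at_right 0)"
    by (auto simp: eventually_at_right_field intro!: exI[of _ 1])
  moreover have "((\<lambda>t. c + K' * t) \<longlongrightarrow> c + K' * 0) (at_right 0)"
    by (intro tendsto_intros)
  ultimately show ?thesis
    using tendsto_lowerbound[of "\<lambda>t. c + K' * t" c "at_right 0"] by simp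
qed

section \<open>Smoothing one coordinate at a time\<close>

definition mean :: "real \<Rightarrow> (real \<Rightarrow> real) \<Rightarrow> real"
  where "mean s \<phi> = integral {0..s} \<phi> / s"

lemma mean_abs_le:
  assumes "0 < s" "continuous_on {0..s} \<phi>" "\<And>u. u \<in> {0..s} \<Longrightarrow> \<bar>\<phi> u\<bar> \<le> c"
  shows "\<bar>mean s \<phi>\<bar> \<le> c"
proof -
  have "\<bar>integral {0..s} \<phi>\<bar> \<le> c * (s - 0)"
    using integral_bound[of 0 s \<phi> c] assms by auto
  then show ?thesis
    using assms(1) by (simp add: mean_def field_simps)
qed

lemma mean_diff:
  assumes "continuous_on {0..s} \<phi>" "continuous_on {0..s} \<psi>"
  shows "mean s (\<lambda>u. \<phi> u - \<psi> u) = mean s \<phi> - mean s \<psi>"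
  using assms
  by (simp add: mean_def diff_divide_distrib integral_diff integrable_continuous_interval)

lemma mean_cmult: "mean s (\<lambda>u. c * \<phi> u) = c * mean s \<phi>"
  by (simp add: mean_def)

lemma mean_const: "0 < s \<Longrightarrow> mean s (\<lambda>_. c) = c"
  by (simp add: mean_def)

text \<open>
  If \<open>\<Psi>\<close> is a primitive of \<open>\<psi>\<close>, then \<open>s\<close> times the mean over the window that starts at \<open>v\<close> is
  \<open>\<Psi> (v + s) - \<Psi> v\<close>, whose derivative \<open>\<psi> (v + s) - \<psi> v\<close> is \<open>2\<close>-Lipschitz in \<open>v\<close>;
  hence the quadratic error.
\<close>

lemma mean_gradient:
  fixes \<psi> :: "real \<Rightarrow> real"
  assumes "0 < s" and lip: "\<And>u v. \<bar>\<psi> u - \<psi> v\<bar> \<le> \<bar>u - v\<bar>"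
  shows "\<bar>mean s (\<lambda>u. \<psi> (t + u)) - mean s \<psi> - t * ((\<psi> s - \<psi> 0) / s)\<bar> \<le> 2 / s * t\<^sup>2"
proof -
  have cont: "continuous_on T \<psi>" for T
    using lip by (intro lipschitz_on_continuous_on[of 1] lipschitz_onI) (auto simp: dist_real_def)
  \<comment> \<open>Large enough for all windows that start in \<open>[-\<bar>t\<bar>, \<bar>t\<bar>]\<close> to lie in the interior of \<open>[-R, R]\<close>.\<close>
  define R where "R = \<bar>t\<bar> + s + 1"
  obtain \<Psi> where \<Psi>: "\<And>u. u \<in> {-R..R} \<Longrightarrow> (\<Psi> has_vector_derivative \<psi> u) (at u within {-R..R})"
    using antiderivative_continuous[OF cont[of "{-R..R}"]] by blast
  have deriv: "(\<Psi> has_real_derivative \<psi> u) (at u)" if "\<bar>u\<bar> < R" for u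
  proof -
    have "at u within {-R..R} = at u" using that by (intro at_within_interior) auto
    moreover have "u \<in> {-R..R}" using that by auto
    ultimately show ?thesis
      using \<Psi>[of u] by (simp add: has_real_derivative_iff_has_vector_derivative)
  qed
  have window: "integral {0..s} (\<lambda>u. \<psi> (v + u)) = \<Psi> (v + s) - \<Psi> v" if "\<bar>v\<bar> \<le> \<bar>t\<bar>" for v
  proof -
    have "((\<lambda>u. \<psi> (v + u)) has_integral \<Psi> (v + s) - \<Psi> (v + 0)) {0..s}"
    proof (rule fundamental_theorem_of_calculus)
      fix u assume "u \<in> {0..s}"
      then have "\<bar>v + u\<bar> < R" using that by (auto simp: R_def)
      from deriv[OF this] have "((\<lambda>u. \<Psi> (v + u)) has_real_derivative \<psi> (v + u)) (at u)"
        by (simp add: DERIV_shift add.commute)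
      then show "((\<lambda>u. \<Psi> (v + u)) has_vector_derivative \<psi> (v + u)) (at u within {0..s})"
        by (simp add: has_real_derivative_iff_has_vector_derivative has_vector_derivative_at_within)
    qed (use assms in simp)
    then show ?thesis by (simp add: integral_unique)
  qed
  define h where "h v = \<Psi> (v + s) - \<Psi> v - v * (\<psi> s - \<psi> 0)" for v
  have "norm (h t - h 0) \<le> 2 * \<bar>t\<bar> * norm (t - 0)"
  proof (rule field_differentiable_bound)
    show "convex (cball (0::real) \<bar>t\<bar>)" by simp
    fix v assume v: "v \<in> cball (0::real) \<bar>t\<bar>"
    then have "\<bar>v\<bar> < R" "\<bar>v + s\<bar> < R" using assms by (auto simp: R_def)
    then have "(\<Psi> has_real_derivative \<psi> v) (at v)" "((\<lambda>v. \<Psi> (v + s)) has_real_derivative \<psi> (v + s)) (at v)"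
      by (simp_all add: deriv flip: DERIV_shift)
    then have "(h has_real_derivative \<psi> (v + s) - \<psi> v - (\<psi> s - \<psi> 0)) (at v)"
      unfolding h_def by (auto intro!: derivative_eq_intros)
    then show "(h has_real_derivative \<psi> (v + s) - \<psi> v - (\<psi> s - \<psi> 0)) (at v within cball 0 \<bar>t\<bar>)"
      by (rule has_field_derivative_at_within)
    show "norm (\<psi> (v + s) - \<psi> v - (\<psi> s - \<psi> 0)) \<le> 2 * \<bar>t\<bar>"
      using lip[of "v + s" s] lip[of v 0] v by auto
  qed auto
  moreover have "h t - h 0 = s * (mean s (\<lambda>u. \<psi> (t + u)) - mean s \<psi> - t * ((\<psi> s - \<psi> 0) / s))"
  proof -
    have "s * mean s \<phi> = integral {0..s} \<phi>" for \<phi> using assms by (simp add: mean_def)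
    moreover have "s * (t * ((\<psi> s - \<psi> 0) / s)) = t * (\<psi> s - \<psi> 0)" using assms by simp
    ultimately show ?thesis
      unfolding right_diff_distrib[of s] using window[of t] window[of 0] by (simp add: h_def)
  qed
  ultimately have "s * \<bar>mean s (\<lambda>u. \<psi> (t + u)) - mean s \<psi> - t * ((\<psi> s - \<psi> 0) / s)\<bar> \<le> 2 * t\<^sup>2"
    using assms by (simp add: abs_mult power2_eq_square)
  then show ?thesis
    using assms by (simp add: pos_le_divide_eq mult.commute)
qed

definition smooth_coord :: "'a \<Rightarrow> real \<Rightarrow> (('a \<Rightarrow> real) \<Rightarrow> real) \<Rightarrow> ('a \<Rightarrow> real) \<Rightarrow> real"
  where "smooth_coord a s f x = mean s (\<lambda>u. f (shift a u x))"

text \<open>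
  Averages of translates of \<open>f\<close> inherit all bounds on increments of \<open>f\<close> along a fixed direction that
  are uniform in the base point. Stating this for all directions at once makes smoothing
  independent of the two norms that matter for the margin.
\<close>

definition increment_bounds_inherited ::
    "(('a \<Rightarrow> real) \<Rightarrow> real) \<Rightarrow> (('a \<Rightarrow> real) \<Rightarrow> real) \<Rightarrow> bool"
  where "increment_bounds_inherited f f' \<longleftrightarrow>
    (\<forall>H c. (\<forall>x. \<bar>f (\<lambda>a. x a + H a) - f x\<bar> \<le> c) \<longrightarrow> (\<forall>x. \<bar>f' (\<lambda>a. x a + H a) - f' x\<bar> \<le> c))"

lemma l1_lipschitz_inherited:
  assumes "increment_bounds_inherited f f'" "l1_lipschitz I K f"
  shows "l1_lipschitz I K f'"
  unfolding l1_lipschitz_def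
proof (intro allI)
  fix x y :: "'a \<Rightarrow> real"
  have "\<bar>f (\<lambda>a. z a + (x a - y a)) - f z\<bar> \<le> K * (\<Sum>b\<in>I. \<bar>x b - y b\<bar>)" for z
    using assms(2) unfolding l1_lipschitz_def
    by (metis (no_types, lifting) add_diff_cancel_left' sum.cong)
  then have "\<bar>f' (\<lambda>a. z a + (x a - y a)) - f' z\<bar> \<le> K * (\<Sum>b\<in>I. \<bar>x b - y b\<bar>)" for z
    using assms(1)[unfolded increment_bounds_inherited_def, rule_format, of "\<lambda>a. x a - y a"] by blast
  from this[of y] show "\<bar>f' x - f' y\<bar> \<le> K * (\<Sum>b\<in>I. \<bar>x b - y b\<bar>)" by simp
qed

context
  fixes I :: "'a set" and a :: 'a and s :: real
  assumes I: "finite I" "a \<in> I" and s: "0 < s"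
begin

lemma increment_bounds_smooth_coord:
  assumes "l1_lipschitz I K f"
  shows "increment_bounds_inherited f (smooth_coord a s f)"
  unfolding increment_bounds_inherited_def
proof (intro allI impI)
  fix H c x assume c: "\<forall>x. \<bar>f (\<lambda>a. x a + H a) - f x\<bar> \<le> c"
  have "shift a u (\<lambda>i. x i + H i) = (\<lambda>i. shift a u x i + H i)" for u
    by (auto simp: shift_def)
  then have "\<bar>f (shift a u (\<lambda>i. x i + H i)) - f (shift a u x)\<bar> \<le> c" for u
    using c by simp
  then show "\<bar>smooth_coord a s f (\<lambda>a. x a + H a) - smooth_coord a s f x\<bar> \<le> c"
    unfolding smooth_coord_def using s assms I
    by (subst mean_diff[symmetric]) (auto intro!: mean_abs_le continuous_intros continuous_on_shift)
qed

lemma smooth_coord_close: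
  assumes "l1_lipschitz I 1 f"
  shows "\<bar>smooth_coord a s f x - f x\<bar> \<le> s"
proof -
  have "\<bar>f (shift a u x) - f x\<bar> \<le> s" if "u \<in> {0..s}" for u
    using l1_lipschitz_shift[OF I assms, of u x 0] that by (simp add: shift_def)
  then have "\<bar>mean s (\<lambda>u. f (shift a u x) - f x)\<bar> \<le> s"
    using s assms I by (auto intro!: mean_abs_le continuous_intros continuous_on_shift)
  then show ?thesis
    using s assms I by (subst (asm) mean_diff)
      (auto simp: mean_const smooth_coord_def intro!: continuous_intros continuous_on_shift)
qed

lemma smooth_coord_bounded:
  assumes "l1_lipschitz I K f" "\<And>x. \<bar>f x\<bar> \<le> R"
  shows "\<bar>smooth_coord a s f x\<bar> \<le> R"
  unfolding smooth_coord_def using s assms I by (auto intro!: mean_abs_le continuous_on_shift)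

text \<open>
  Smoothing in direction \<open>a\<close> does not spoil the directions treated before, because it is an average over
  translates and translations commute.
\<close>

lemma smooth_coord_keeps_gradient:
  assumes "l1_lipschitz I 1 f" "has_gradient_on I J K f g" "J \<subseteq> I"
  shows "has_gradient_on I J K (smooth_coord a s f) (\<lambda>b. smooth_coord a s (g b))"
  unfolding has_gradient_on_def
proof (intro conjI ballI allI)
  show "0 \<le> K" using assms by (simp add: has_gradient_on_def)
next
  fix b assume "b \<in> J"
  with assms have b: "b \<in> I" and g: "l1_lipschitz I K (g b)"
    and grad: "\<And>x t. \<bar>f (shift b t x) - f x - t * g b x\<bar> \<le> K * t\<^sup>2"
    by (auto simp: has_gradient_on_def)
  show "l1_lipschitz I K (smooth_coord a s (g b))"
    using increment_bounds_smooth_coord[OF g] g by (rule l1_lipschitz_inherited)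
  fix x t
  have "shift a u (shift b t x) = shift b t (shift a u x)" for u
    by (auto simp: shift_def)
  then have "\<bar>f (shift a u (shift b t x)) - f (shift a u x) - t * g b (shift a u x)\<bar> \<le> K * t\<^sup>2" for u
    using grad by simp
  then have "\<bar>mean s (\<lambda>u. f (shift a u (shift b t x)) - f (shift a u x) - t * g b (shift a u x))\<bar> \<le> K * t\<^sup>2"
    using s assms(1) g I by (auto intro!: mean_abs_le continuous_intros continuous_on_shift)
  then show "\<bar>smooth_coord a s f (shift b t x) - smooth_coord a s f x - t * smooth_coord a s (g b) x\<bar>
      \<le> K * t\<^sup>2"
    unfolding smooth_coord_def using s assms(1) g I
    by (simp add: mean_diff mean_cmult continuous_on_diff continuous_on_mult_left continuous_on_shift)
qed

lemma smooth_coord_gains_gradient: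
  assumes f: "l1_lipschitz I 1 f"
  shows "has_gradient_on I {a} (2 / s) (smooth_coord a s f) (\<lambda>_ x. (f (shift a s x) - f x) / s)"
  unfolding has_gradient_on_def l1_lipschitz_def
proof (intro conjI ballI allI)
  fix b assume "b \<in> {a}" then have b: "b = a" by simp
  {
    fix x y :: "'a \<Rightarrow> real"
    have "(\<Sum>b\<in>I. \<bar>shift a s x b - shift a s y b\<bar>) = (\<Sum>b\<in>I. \<bar>x b - y b\<bar>)"
      by (intro sum.cong) (auto simp: shift_def)
    then have "\<bar>f (shift a s x) - f (shift a s y)\<bar> \<le> (\<Sum>b\<in>I. \<bar>x b - y b\<bar>)"
      using f unfolding l1_lipschitz_def by (metis mult_1)
    moreover have "\<bar>f x - f y\<bar> \<le> (\<Sum>b\<in>I. \<bar>x b - y b\<bar>)"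
      using f by (simp add: l1_lipschitz_def)
    ultimately have "\<bar>(f (shift a s x) - f x) - (f (shift a s y) - f y)\<bar> / s \<le> 2 * (\<Sum>b\<in>I. \<bar>x b - y b\<bar>) / s"
      using s by (intro divide_right_mono) auto
    then show "\<bar>(f (shift a s x) - f x) / s - (f (shift a s y) - f y) / s\<bar> \<le> 2 / s * (\<Sum>b\<in>I. \<bar>x b - y b\<bar>)"
      using s by (simp add: diff_divide_distrib[symmetric])
  }
  fix x t
  have "\<bar>f (shift a u x) - f (shift a v x)\<bar> \<le> \<bar>u - v\<bar>" for u v
    using l1_lipschitz_shift[OF I f] by simp
  from mean_gradient[OF s this, of t]
  show "\<bar>smooth_coord a s f (shift b t x) - smooth_coord a s f x - t * ((f (shift a s x) - f x) / s)\<bar>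
      \<le> 2 / s * t\<^sup>2"
    by (simp add: b smooth_coord_def shift_def add.assoc)
qed (use s in auto)

end

lemma has_gradient_on_mono:
  assumes "has_gradient_on I J K f g" "K \<le> K'"
  shows "has_gradient_on I J K' f g"
proof -
  have "K * (\<Sum>b\<in>I. \<bar>x b - y b\<bar>) \<le> K' * (\<Sum>b\<in>I. \<bar>x b - y b\<bar>)" for x y :: "'a \<Rightarrow> real"
    using assms(2) by (intro mult_right_mono sum_nonneg) auto
  moreover have "K * t\<^sup>2 \<le> K' * t\<^sup>2" for t
    using assms(2) by (intro mult_right_mono) auto
  ultimately show ?thesis
    using assms unfolding has_gradient_on_def l1_lipschitz_def by (meson order_trans)
qed

lemma smoothing_exists:
  fixes s :: real
  assumes "finite I" "l1_lipschitz I 1 f" "0 < s" "finite J" "J \<subseteq> I"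
  shows "\<exists>f' g K. increment_bounds_inherited f f' \<and> (\<forall>x. \<bar>f' x - f x\<bar> \<le> card J * s)
    \<and> (\<forall>R. (\<forall>x. \<bar>f x\<bar> \<le> R) \<longrightarrow> (\<forall>x. \<bar>f' x\<bar> \<le> R)) \<and> has_gradient_on I J K f' g"
  using assms(4,5)
proof (induction J rule: finite_induct)
  case empty
  have "has_gradient_on I {} 0 f undefined" by (simp add: has_gradient_on_def)
  then show ?case by (intro exI[of _ f]) (auto simp: increment_bounds_inherited_def)
next
  case (insert a J)
  then obtain f' g K where f': "increment_bounds_inherited f f'" "\<And>x. \<bar>f' x - f x\<bar> \<le> card J * s"
    "\<And>R x. (\<forall>x. \<bar>f x\<bar> \<le> R) \<Longrightarrow> \<bar>f' x\<bar> \<le> R" "has_gradient_on I J K f' g"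
    by auto
  have a: "a \<in> I" using insert by simp
  have lip: "l1_lipschitz I 1 f'" using f'(1) assms(2) by (rule l1_lipschitz_inherited)
  define f'' where "f'' = smooth_coord a s f'"
  define g'' where "g'' b = (if b = a then (\<lambda>x. (f' (shift a s x) - f' x) / s) else smooth_coord a s (g b))" for b
  define K'' where "K'' = max K (2 / s)"
  have "increment_bounds_inherited f f''"
    using increment_bounds_smooth_coord[OF assms(1) a assms(3) lip] f'(1)
    unfolding f''_def increment_bounds_inherited_def by blast
  moreover have "\<bar>f'' x - f x\<bar> \<le> card (insert a J) * s" for x
    using smooth_coord_close[OF assms(1) a assms(3) lip, of x] f'(2)[of x] insert.hyps
    by (simp add: f''_def algebra_simps)
  moreover have "\<bar>f'' x\<bar> \<le> R" if "\<forall>x. \<bar>f x\<bar> \<le> R" for R x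
    unfolding f''_def using smooth_coord_bounded[OF assms(1) a assms(3) lip] f'(3)[OF that] by blast
  moreover have "has_gradient_on I (insert a J) K'' f'' g''"
  proof -
    have "has_gradient_on I J K'' f'' (\<lambda>b. smooth_coord a s (g b))"
      using smooth_coord_keeps_gradient[OF assms(1) a assms(3) lip f'(4)] insert.prems
      unfolding f''_def K''_def by (auto intro: has_gradient_on_mono)
    moreover have "has_gradient_on I {a} K'' f'' (\<lambda>_ x. (f' (shift a s x) - f' x) / s)"
      using smooth_coord_gains_gradient[OF assms(1) a assms(3) lip]
      unfolding f''_def K''_def by (auto intro: has_gradient_on_mono)
    ultimately show ?thesis
      using insert.hyps by (auto simp: has_gradient_on_def g''_def)
  qed
  ultimately show ?case by blast
qed

section \<open>Averaging over permutations of the coordinates\<close>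

text \<open>
  Smoothing treats the coordinates in some order, so a function that is invariant under
  permutations of coordinates may lose that invariance. Averaging over the permutations restores it.
\<close>

definition symmetrise :: "('a \<Rightarrow> 'a) set \<Rightarrow> (('a \<Rightarrow> real) \<Rightarrow> real) \<Rightarrow> ('a \<Rightarrow> real) \<Rightarrow> real"
  where "symmetrise P f x = (\<Sum>p\<in>P. f (x \<circ> p)) / card P"

lemma abs_average_le:
  fixes u :: "'b \<Rightarrow> real"
  assumes "finite P" "P \<noteq> {}" "\<And>p. p \<in> P \<Longrightarrow> \<bar>u p\<bar> \<le> c"
  shows "\<bar>(\<Sum>p\<in>P. u p) / card P\<bar> \<le> c"
proof -
  have "\<bar>\<Sum>p\<in>P. u p\<bar> \<le> (\<Sum>p\<in>P. c)"
    using assms(3) by (intro order_trans[OF sum_abs sum_mono])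
  moreover have "card P > 0" using assms by (simp add: card_gt_0_iff)
  ultimately show ?thesis by (simp add: field_simps)
qed

context
  fixes P :: "('a \<Rightarrow> 'a) set" and I :: "'a set"
  assumes P: "finite P" "P \<noteq> {}"
    and bij: "\<And>p. p \<in> P \<Longrightarrow> bij p"
    and maps: "\<And>p. p \<in> P \<Longrightarrow> p ` I = I"
    and translate: "\<And>p. p \<in> P \<Longrightarrow> bij_betw (\<lambda>r. p \<circ> r) P P"
begin

lemma symmetrise_gradient:
  assumes "has_gradient_on I I K f g"
  shows "has_gradient_on I I K (symmetrise P f) (\<lambda>a x. (\<Sum>p\<in>P. g (inv p a) (x \<circ> p)) / card P)"
  unfolding has_gradient_on_def l1_lipschitz_def
proof (intro conjI ballI allI)
  show "0 \<le> K" using assms by (simp add: has_gradient_on_def)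
next
  fix a assume a: "a \<in> I"
  have inv_in: "inv p a \<in> I" if "p \<in> P" for p
    using bij[OF that] maps[OF that] a by (metis bij_inv_eq_iff imageE)
  {
    fix x y :: "'a \<Rightarrow> real"
    have "\<bar>g (inv p a) (x \<circ> p) - g (inv p a) (y \<circ> p)\<bar> \<le> K * (\<Sum>b\<in>I. \<bar>x b - y b\<bar>)" if "p \<in> P" for p
    proof -
      have "bij_betw p I I"
        using bij[OF that] maps[OF that] by (simp add: bij_betw_def inj_on_subset[OF bij_is_inj])
      then have "(\<Sum>b\<in>I. \<bar>x (p b) - y (p b)\<bar>) = (\<Sum>b\<in>I. \<bar>x b - y b\<bar>)"
        by (rule sum.reindex_bij_betw)
      moreover have "\<bar>g (inv p a) (x \<circ> p) - g (inv p a) (y \<circ> p)\<bar> \<le> K * (\<Sum>b\<in>I. \<bar>x (p b) - y (p b)\<bar>)"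
      proof -
        have "l1_lipschitz I K (g (inv p a))"
          using assms inv_in[OF that] by (simp add: has_gradient_on_def)
        from this[unfolded l1_lipschitz_def, rule_format, of "x \<circ> p" "y \<circ> p"]
        show ?thesis by simp
      qed
      ultimately show ?thesis by simp
    qed
    from abs_average_le[OF P this]
    show "\<bar>(\<Sum>p\<in>P. g (inv p a) (x \<circ> p)) / card P - (\<Sum>p\<in>P. g (inv p a) (y \<circ> p)) / card P\<bar>
        \<le> K * (\<Sum>b\<in>I. \<bar>x b - y b\<bar>)"
      by (simp add: sum_subtractf diff_divide_distrib)
  }
  fix x t
  have "\<bar>f (shift a t x \<circ> p) - f (x \<circ> p) - t * g (inv p a) (x \<circ> p)\<bar> \<le> K * t\<^sup>2" if "p \<in> P" for p
  proof -
    have "shift a t x \<circ> p = shift (inv p a) t (x \<circ> p)"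
    proof
      fix i
      have "p i = a \<longleftrightarrow> i = inv p a" using bij[OF that] by (metis bij_inv_eq_iff)
      then show "(shift a t x \<circ> p) i = shift (inv p a) t (x \<circ> p) i" by (auto simp: shift_def)
    qed
    then show ?thesis
      using assms inv_in[OF that] by (simp add: has_gradient_on_def)
  qed
  from abs_average_le[OF P this]
  show "\<bar>symmetrise P f (shift a t x) - symmetrise P f x - t * ((\<Sum>p\<in>P. g (inv p a) (x \<circ> p)) / card P)\<bar>
      \<le> K * t\<^sup>2"
    by (simp add: symmetrise_def sum_subtractf diff_divide_distrib sum_distrib_left)
qed

text \<open>
  Since \<open>r \<mapsto> p \<circ> r\<close> permutes \<open>P\<close>, the averaged gradient at a permuted coordinate is the averaged
  gradient at the permuted point.
\<close>

lemma symmetrise_gradient_equivariant: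
  assumes "p \<in> P"
  shows "(\<Sum>r\<in>P. g (inv r (p a)) (x \<circ> r)) = (\<Sum>r\<in>P. g (inv r a) (x \<circ> p \<circ> r))"
proof -
  have "inv (p \<circ> r) (p a) = inv r a" if "r \<in> P" for r
    using bij[OF assms] bij[OF that] by (simp add: o_inv_distrib bij_is_inj inv_f_f)
  then show ?thesis
    by (subst sum.reindex_bij_betw[OF translate[OF assms], symmetric]) (simp add: comp_assoc)
qed

end

section \<open>Gaussian vectors as limits of sums of signs\<close>

definition sign_sum :: "nat \<Rightarrow> nat set \<Rightarrow> real"
  where "sign_sum k S = (\<Sum>l<k. if l \<in> S then 1 else -1)"

text \<open>
  The bit \<open>(a, l)\<close> is the sign of the \<open>l\<close>-th step of a walk with \<open>k\<close> steps that approximates the Gaussian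
  coordinate \<open>a\<close>.
\<close>

definition walk :: "nat \<Rightarrow> ('a \<times> nat) set \<Rightarrow> 'a \<Rightarrow> real"
  where "walk k S a = sign_sum k {l. (a, l) \<in> S} / sqrt k"

definition walk_distr :: "nat \<Rightarrow> real measure"
  where "walk_distr k = distr (uniform_count_measure (Pow {..<k})) borel (\<lambda>S. sign_sum k S / sqrt k)"

lemma prob_space_cube: "finite B \<Longrightarrow> prob_space (uniform_count_measure (Pow B))"
  by (rule prob_space_uniform_count_measure) auto

lemma integral_cube: "finite B \<Longrightarrow> integral\<^sup>L (uniform_count_measure (Pow B)) \<phi> = cube_avg B \<phi>"
  by (simp add: integral_uniform_count_measure cube_avg_def card_Pow)

lemma real_distribution_walk: "real_distribution (walk_distr k)"
  unfolding walk_distr_def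
  by (intro prob_space.real_distribution_distr prob_space_cube) (auto simp: uniform_count_measure_def)

lemma sum_cube_iexp: "(\<Sum>S\<in>Pow {..<k}. iexp (u * sign_sum k S)) = (2 * complex_of_real (cos u)) ^ k"
proof (induction k)
  case 0
  then show ?case by (simp add: sign_sum_def)
next
  case (Suc k)
  have step: "sign_sum (Suc k) S = sign_sum k S - 1" "sign_sum (Suc k) (insert k S) = sign_sum k S + 1"
    if "S \<subseteq> {..<k}" for S
  proof -
    have "k \<notin> S" using that by auto
    moreover have "(\<Sum>l<k. if l \<in> insert k S then 1 else -1) = (\<Sum>l<k. if l \<in> S then 1 else (-1::real))"
      by (intro sum.cong) auto
    ultimately show "sign_sum (Suc k) S = sign_sum k S - 1" "sign_sum (Suc k) (insert k S) = sign_sum k S + 1"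
      by (simp_all add: sign_sum_def)
  qed
  have "inj_on (insert k) (Pow {..<k})" "Pow {..<k} \<inter> insert k ` Pow {..<k} = {}"
    by (auto simp: inj_on_def)
  then have "(\<Sum>S\<in>Pow {..<Suc k}. iexp (u * sign_sum (Suc k) S))
      = (\<Sum>S\<in>Pow {..<k}. iexp (u * sign_sum (Suc k) S))
        + (\<Sum>S\<in>Pow {..<k}. iexp (u * sign_sum (Suc k) (insert k S)))"
    by (simp add: lessThan_Suc Pow_insert sum.union_disjoint sum.reindex)
  also have "\<dots> = (\<Sum>S\<in>Pow {..<k}. iexp (u * sign_sum k S) * (iexp (- u) + iexp u))"
    by (simp add: step algebra_simps flip: sum.distrib exp_add)
  also have "iexp (- u) + iexp u = 2 * complex_of_real (cos u)"
    by (simp add: cos_exp_eq cos_of_real[symmetric] add.commute)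
  finally show ?case
    by (simp only: Suc.IH sum_distrib_right[symmetric] power_Suc2)
qed

lemma char_walk: "char (walk_distr k) t = complex_of_real (cos (t / sqrt k) ^ k)"
proof -
  have "char (walk_distr k) t = (CLINT S|uniform_count_measure (Pow {..<k}). iexp (t * (sign_sum k S / sqrt k)))"
    unfolding char_def walk_distr_def
    by (rule integral_distr) (auto simp: uniform_count_measure_def)
  also have "\<dots> = (\<Sum>S\<in>Pow {..<k}. iexp (t / sqrt k * sign_sum k S)) / 2 ^ k"
    unfolding uniform_count_measure_def
    by (subst lebesgue_integral_point_measure_finite)
      (auto simp: card_Pow sum_divide_distrib scaleR_conv_of_real intro!: sum.cong)
  also have "\<dots> = complex_of_real (cos (t / sqrt k) ^ k)"
    unfolding sum_cube_iexp by (simp add: power_mult_distrib)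
  finally show ?thesis .
qed

text \<open>
  By Levy's continuity theorem: the characteristic function of the walk is \<open>cos (t / sqrt k) ^ k\<close>.
\<close>

lemma walk_CLT: "weak_conv_m walk_distr std_normal_distribution"
proof (rule levy_continuity[OF real_distribution_walk real_dist_normal_dist])
  fix t :: real
  have "(\<lambda>k. cos (t / sqrt (real k)) ^ k) \<longlonglongrightarrow> exp (- (t * t / 2))"
    by real_asymp
  also have "- (t * t / 2) = - t\<^sup>2 / 2" by (simp add: power2_eq_square)
  finally show "(\<lambda>k. char (walk_distr k) t) \<longlonglongrightarrow> char std_normal_distribution t"
    unfolding char_walk char_std_normal_distribution by (rule tendsto_of_real)
qed

text \<open>
  A subset of \<open>I \<times> {..<k}\<close> is a family of subsets of \<open>{..<k}\<close> indexed by \<open>I\<close>, so counting points of the cube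
  whose walk lies in a box factorises.
\<close>

lemma walk_distr_product:
  assumes "finite I"
  shows "distr (uniform_count_measure (Pow (I \<times> {..<k}))) (Pi\<^sub>M I (\<lambda>_. borel)) (\<lambda>S. restrict (walk k S) I)
    = Pi\<^sub>M I (\<lambda>_. walk_distr k)"
proof (rule product_sigma_finite.PiM_eqI)
  let ?U = "uniform_count_measure (Pow (I \<times> {..<k}))"
  interpret W: real_distribution "walk_distr k" by (rule real_distribution_walk)
  show "product_sigma_finite (\<lambda>_. walk_distr k)" by unfold_locales
  show "sets (distr ?U (Pi\<^sub>M I (\<lambda>_. borel)) (\<lambda>S. restrict (walk k S) I)) = sets (Pi\<^sub>M I (\<lambda>_. walk_distr k))"
    by (simp cong: sets_PiM_cong)
  fix A :: "'a \<Rightarrow> real set" assume A: "\<And>a. a \<in> I \<Longrightarrow> A a \<in> sets (walk_distr k)"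
  define T where "T a = {S \<in> Pow {..<k}. sign_sum k S / sqrt k \<in> A a}" for a
  define X where "X = {S \<in> Pow (I \<times> {..<k}). restrict (walk k S) I \<in> Pi\<^sub>E I A}"
  have "bij_betw (\<lambda>S. \<lambda>a\<in>I. {l. (a, l) \<in> S}) X (Pi\<^sub>E I T)"
  proof (rule bij_betw_byWitness[where f' = "Sigma I"])
    show "\<forall>f\<in>Pi\<^sub>E I T. (\<lambda>a\<in>I. {l. (a, l) \<in> Sigma I f}) = f"
      by (auto simp: fun_eq_iff PiE_def extensional_def)
    have "Sigma I f \<subseteq> I \<times> {..<k}" if "f \<in> Pi\<^sub>E I T" for f
      using that by (fastforce simp: T_def PiE_iff)
    moreover have "walk k (Sigma I f) a \<in> A a" if "f \<in> Pi\<^sub>E I T" "a \<in> I" for f a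
      using that by (auto simp: T_def walk_def PiE_iff)
    ultimately show "Sigma I ` Pi\<^sub>E I T \<subseteq> X"
      by (auto simp: X_def)
  qed (auto simp: T_def walk_def PiE_iff X_def)
  moreover have X_subset: "X \<subseteq> Pow (I \<times> {..<k})" by (auto simp: X_def)
  ultimately have card: "card X = (\<Prod>a\<in>I. card (T a))"
    using assms by (simp add: bij_betw_same_card card_PiE)
  have "emeasure (distr ?U (Pi\<^sub>M I (\<lambda>_. borel)) (\<lambda>S. restrict (walk k S) I)) (Pi\<^sub>E I A)
      = emeasure ?U X"
    using A assms
    by (subst emeasure_distr) (auto simp: X_def uniform_count_measure_def space_PiM point_measure_def
        intro!: arg_cong2[where f = emeasure] sets_PiM_I_finite)
  also have "\<dots> = ennreal ((\<Prod>a\<in>I. real (card (T a))) / 2 ^ (card I * k))"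
    using assms
    by (subst emeasure_uniform_count_measure) (simp_all add: X_def[symmetric] card card_Pow card_cartesian_product X_subset)
  also have "\<dots> = (\<Prod>a\<in>I. ennreal (card (T a) / 2 ^ k))"
    by (simp add: prod_ennreal prod_dividef power_mult mult.commute)
  also have "\<dots> = (\<Prod>a\<in>I. emeasure (walk_distr k) (A a))"
  proof (intro prod.cong refl)
    fix a assume "a \<in> I"
    then have "emeasure (walk_distr k) (A a) = emeasure (uniform_count_measure (Pow {..<k})) (T a)"
      using A[of a] unfolding walk_distr_def
      by (subst emeasure_distr) (auto simp: uniform_count_measure_def point_measure_def T_def
          intro!: arg_cong2[where f = emeasure])
    also have "\<dots> = ennreal (card (T a) / 2 ^ k)"
      by (subst emeasure_uniform_count_measure) (auto simp: T_def card_Pow)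
    finally show "ennreal (card (T a) / 2 ^ k) = emeasure (walk_distr k) (A a)" by simp
  qed
  finally show "emeasure (distr ?U (Pi\<^sub>M I (\<lambda>_. borel)) (\<lambda>S. restrict (walk k S) I)) (Pi\<^sub>E I A)
      = (\<Prod>a\<in>I. emeasure (walk_distr k) (A a))" .
qed (use assms in simp)

lemma l1_lipschitz_measurable:
  fixes G :: "('a::countable \<Rightarrow> real) \<Rightarrow> real"
  assumes "l1_lipschitz I K G"
  shows "G \<in> borel_measurable (Pi\<^sub>M I (\<lambda>_. borel))"
proof -
  have "continuous_on UNIV G"
    unfolding continuous_on_def
    by (intro ballI l1_lipschitz_tendsto[OF assms] tendsto_intros)
      (metis UNIV_I continuous_on_def continuous_on_product_coordinates)
  then have "G \<in> borel_measurable borel"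
    by (rule borel_measurable_continuous_onI)
  moreover have "(\<lambda>x i. if i \<in> I then x i else (0::real)) \<in> Pi\<^sub>M I (\<lambda>_. borel) \<rightarrow>\<^sub>M borel"
  proof (rule measurable_coordinatewise_then_product)
    fix i show "(\<lambda>x. if i \<in> I then x i else (0::real)) \<in> borel_measurable (Pi\<^sub>M I (\<lambda>_. borel))"
      by (cases "i \<in> I") auto
  qed
  ultimately have "(\<lambda>x. G (\<lambda>i. if i \<in> I then x i else 0)) \<in> borel_measurable (Pi\<^sub>M I (\<lambda>_. borel))"
    by (rule measurable_compose[rotated])
  moreover have "G (\<lambda>i. if i \<in> I then x i else 0) = G x" for x
    by (rule l1_lipschitz_cong[OF assms]) simp
  ultimately show ?thesis by simp
qed

text \<open>
  Skorohod's theorem realises the one-dimensional convergence pointwise on some space \<open>\<Omega>\<close>. The same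
  coupling in each factor of the power of \<open>\<Omega>\<close> indexed by \<open>I\<close> gives pointwise convergence of the vectors, and
  dominated convergence applies.
\<close>

lemma walk_CLT_product:
  fixes G :: "('a::countable \<Rightarrow> real) \<Rightarrow> real"
  assumes I: "finite I" and G: "l1_lipschitz I K G" and bound: "\<And>x. \<bar>G x\<bar> \<le> R"
  shows "(\<lambda>k. cube_avg (I \<times> {..<k}) (\<lambda>S. G (walk k S)))
    \<longlonglongrightarrow> (\<integral>x. G x \<partial>Pi\<^sub>M I (\<lambda>_. std_normal_distribution))"
proof -
  interpret N: real_distribution std_normal_distribution by (rule real_dist_normal_dist)
  interpret W: real_distribution "walk_distr k" for k by (rule real_distribution_walk)
  obtain \<Omega> :: "real measure" and Y Z where coupling: "prob_space \<Omega> \<and> (\<forall>k. Y k \<in> borel_measurable \<Omega>)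
    \<and> (\<forall>k. distr \<Omega> borel (Y k) = walk_distr k) \<and> Z \<in> \<Omega> \<rightarrow>\<^sub>M lborel
    \<and> distr \<Omega> borel Z = std_normal_distribution \<and> (\<forall>\<omega>\<in>space \<Omega>. (\<lambda>k. Y k \<omega>) \<longlonglongrightarrow> Z \<omega>)"
    using Skorohod[OF real_distribution_walk real_dist_normal_dist walk_CLT] by blast
  then have \<Omega>: "prob_space \<Omega>"
    and Y [measurable]: "\<And>k. Y k \<in> borel_measurable \<Omega>" and Y_distr: "\<And>k. distr \<Omega> borel (Y k) = walk_distr k"
    and Z [measurable]: "Z \<in> borel_measurable \<Omega>" and Z_distr: "distr \<Omega> borel Z = std_normal_distribution"
    and conv: "\<And>\<omega>. \<omega> \<in> space \<Omega> \<Longrightarrow> (\<lambda>k. Y k \<omega>) \<longlonglongrightarrow> Z \<omega>"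
    by (simp_all add: measurable_lborel2)
  interpret \<Omega>: prob_space \<Omega> by (rule \<Omega>)
  interpret P: prob_space "Pi\<^sub>M I (\<lambda>_. \<Omega>)" by (rule prob_space_PiM) (rule \<Omega>)
  have meas: "G \<in> borel_measurable (Pi\<^sub>M I (\<lambda>_. \<nu>))" if "sets \<nu> = sets borel" for \<nu>
    using l1_lipschitz_measurable[OF G] that measurable_cong_sets[OF sets_PiM_cong[of I I "\<lambda>_. \<nu>" "\<lambda>_. borel"] refl]
    by simp
  have coupled: "(\<integral>x. G x \<partial>Pi\<^sub>M I (\<lambda>_. \<nu>)) = (\<integral>\<omega>. G (\<lambda>a. V (\<omega> a)) \<partial>Pi\<^sub>M I (\<lambda>_. \<Omega>))"
    if \<nu>: "prob_space \<nu>" "sets \<nu> = sets borel" and V: "V \<in> borel_measurable \<Omega>" "distr \<Omega> borel V = \<nu>" for \<nu> V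
  proof -
    have V_meas: "V \<in> \<Omega> \<rightarrow>\<^sub>M \<nu>" using V(1) \<nu>(2) by (simp cong: measurable_cong_sets)
    have "distr \<Omega> \<nu> V = \<nu>" using V(2) \<nu>(2) by (metis distr_cong)
    then have "distr (Pi\<^sub>M I (\<lambda>_. \<Omega>)) (Pi\<^sub>M I (\<lambda>_. \<nu>)) (compose I V) = Pi\<^sub>M I (\<lambda>_. \<nu>)"
      using distr_PiM_finite_prob_space'[OF I, of "\<lambda>_. \<Omega>" "\<lambda>_. \<nu>" V] \<Omega> \<nu>(1) V_meas by simp
    then have "(\<integral>x. G x \<partial>Pi\<^sub>M I (\<lambda>_. \<nu>)) = (\<integral>x. G x \<partial>distr (Pi\<^sub>M I (\<lambda>_. \<Omega>)) (Pi\<^sub>M I (\<lambda>_. \<nu>)) (compose I V))"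
      by simp
    also have "\<dots> = (\<integral>\<omega>. G (compose I V \<omega>) \<partial>Pi\<^sub>M I (\<lambda>_. \<Omega>))"
    proof (rule integral_distr)
      show "compose I V \<in> Pi\<^sub>M I (\<lambda>_. \<Omega>) \<rightarrow>\<^sub>M Pi\<^sub>M I (\<lambda>_. \<nu>)"
        unfolding compose_def using V_meas by measurable
    qed (rule meas[OF \<nu>(2)])
    also have "\<dots> = (\<integral>\<omega>. G (\<lambda>a. V (\<omega> a)) \<partial>Pi\<^sub>M I (\<lambda>_. \<Omega>))"
      by (intro Bochner_Integration.integral_cong refl l1_lipschitz_cong[OF G]) (simp add: compose_def)
    finally show ?thesis .
  qed
  have V_meas: "(\<lambda>\<omega>. G (\<lambda>a. V (\<omega> a))) \<in> borel_measurable (Pi\<^sub>M I (\<lambda>_. \<Omega>))"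
    if [measurable]: "V \<in> borel_measurable \<Omega>" for V
  proof -
    have "(\<lambda>\<omega>. G (\<lambda>a\<in>I. V (\<omega> a))) \<in> borel_measurable (Pi\<^sub>M I (\<lambda>_. \<Omega>))"
      by (rule measurable_compose[OF _ l1_lipschitz_measurable[OF G]]) measurable
    moreover have "G (\<lambda>a\<in>I. V (\<omega> a)) = G (\<lambda>a. V (\<omega> a))" for \<omega>
      by (rule l1_lipschitz_cong[OF G]) simp
    ultimately show ?thesis by simp
  qed
  have "cube_avg (I \<times> {..<k}) (\<lambda>S. G (walk k S)) = (\<integral>\<omega>. G (\<lambda>a. Y k (\<omega> a)) \<partial>Pi\<^sub>M I (\<lambda>_. \<Omega>))" for k
  proof -
    have "cube_avg (I \<times> {..<k}) (\<lambda>S. G (walk k S)) = cube_avg (I \<times> {..<k}) (\<lambda>S. G (restrict (walk k S) I))"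
      by (intro cube_avg_cong l1_lipschitz_cong[OF G]) simp
    also have "\<dots> = (\<integral>S. G (restrict (walk k S) I) \<partial>uniform_count_measure (Pow (I \<times> {..<k})))"
      using I by (simp add: integral_cube)
    also have "\<dots> = (\<integral>x. G x \<partial>Pi\<^sub>M I (\<lambda>_. walk_distr k))"
      unfolding walk_distr_product[OF I, symmetric]
      by (rule integral_distr[symmetric]) (auto simp: l1_lipschitz_measurable[OF G]
          uniform_count_measure_def point_measure_def space_PiM)
    also have "\<dots> = (\<integral>\<omega>. G (\<lambda>a. Y k (\<omega> a)) \<partial>Pi\<^sub>M I (\<lambda>_. \<Omega>))"
      by (rule coupled) (auto simp: Y_distr W.prob_space_axioms)
    finally show ?thesis .
  qed
  moreover have "(\<lambda>k. \<integral>\<omega>. G (\<lambda>a. Y k (\<omega> a)) \<partial>Pi\<^sub>M I (\<lambda>_. \<Omega>)) \<longlonglongrightarrow> (\<integral>\<omega>. G (\<lambda>a. Z (\<omega> a)) \<partial>Pi\<^sub>M I (\<lambda>_. \<Omega>))"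
  proof (rule integral_dominated_convergence[where w = "\<lambda>_. R"])
    show "AE \<omega> in Pi\<^sub>M I (\<lambda>_. \<Omega>). (\<lambda>k. G (\<lambda>a. Y k (\<omega> a))) \<longlonglongrightarrow> G (\<lambda>a. Z (\<omega> a))"
    proof (rule AE_I2)
      fix \<omega> assume "\<omega> \<in> space (Pi\<^sub>M I (\<lambda>_. \<Omega>))"
      then show "(\<lambda>k. G (\<lambda>a. Y k (\<omega> a))) \<longlonglongrightarrow> G (\<lambda>a. Z (\<omega> a))"
        by (intro l1_lipschitz_tendsto[OF G] conv) (auto simp: space_PiM)
    qed
  qed (auto simp: bound V_meas)
  moreover have "(\<integral>\<omega>. G (\<lambda>a. Z (\<omega> a)) \<partial>Pi\<^sub>M I (\<lambda>_. \<Omega>)) = (\<integral>x. G x \<partial>Pi\<^sub>M I (\<lambda>_. std_normal_distribution))"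
    by (rule coupled[symmetric]) (auto simp: Z_distr N.prob_space_axioms)
  ultimately show ?thesis by simp
qed

section \<open>From the cube to Gaussian measure\<close>

lemma walk_insert:
  assumes "l < k"
  shows "walk k (insert (a, l) S) = shift a (2 / sqrt k) (walk k (S - {(a, l)}))"
proof
  fix b
  show "walk k (insert (a, l) S) b = shift a (2 / sqrt k) (walk k (S - {(a, l)})) b"
  proof (cases "b = a")
    case True
    have "sign_sum k {m. (a, m) \<in> insert (a, l) S} - sign_sum k {m. (a, m) \<in> S - {(a, l)}}
        = (\<Sum>m<k. if m = l then 2 else 0)"
      unfolding sign_sum_def sum_subtractf[symmetric] by (intro sum.cong) auto
    also have "\<dots> = 2" using assms by simp
    finally have *: "sign_sum k {m. (a, m) \<in> insert (a, l) S} = sign_sum k {m. (a, m) \<in> S - {(a, l)}} + 2"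
      by simp
    show ?thesis
      unfolding walk_def shift_def True * by (simp add: add_divide_distrib)
  next
    case False
    then have "{m. (b, m) \<in> insert (a, l) S} = {m. (b, m) \<in> S - {(a, l)}}" by auto
    then show ?thesis using False by (simp only: walk_def shift_def fun_upd_apply if_False)
  qed
qed

text \<open>
  Switching one bit moves one coordinate of the walk by \<open>2 h\<close>, so the difference is \<open>2 h\<close> times a partial
  derivative up to \<open>O(h\<^sup>2)\<close>. The derivative is taken at the point \<open>S\<close> itself, which may be either end of
  that move.
\<close>

lemma bit_diff_walk_le:
  fixes h :: real
  assumes I: "finite I" "a \<in> I" and g: "has_gradient_on I I K f g" and "l < k"
  defines "h \<equiv> 1 / sqrt k"
  shows "\<bar>bit_diff (a, l) (\<lambda>S. f (walk k S)) S\<bar> \<le> h * (2 * \<bar>g a (walk k S)\<bar> + 8 * K * h)"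
proof -
  define y where "y = walk k (S - {(a, l)})"
  have K: "0 \<le> K" using g by (simp add: has_gradient_on_def)
  have h: "0 < h" using \<open>l < k\<close> by (simp add: h_def)
  have ins: "walk k (insert (a, l) S) = shift a (2 * h) y"
    using walk_insert[OF \<open>l < k\<close>, of a S] by (simp add: h_def y_def)
  have "\<bar>f (shift a (2 * h) y) - f y - 2 * h * g a y\<bar> \<le> K * (2 * h)\<^sup>2"
    using g I unfolding has_gradient_on_def by blast
  moreover have "\<bar>2 * h * g a y\<bar> \<le> 2 * h * (\<bar>g a (walk k S)\<bar> + 2 * K * h)"
  proof -
    have "walk k S = shift a 0 y \<or> walk k S = shift a (2 * h) y"
      using ins by (cases "(a, l) \<in> S") (auto simp: y_def insert_absorb shift_def)
    moreover have "l1_lipschitz I K (g a)" using g I by (simp add: has_gradient_on_def)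
    ultimately have "\<bar>g a (walk k S) - g a (shift a 0 y)\<bar> \<le> K * (2 * h)"
      using l1_lipschitz_shift[OF I, of K "g a" 0 y 0] l1_lipschitz_shift[OF I, of K "g a" "2 * h" y 0] K h
      by auto
    then have "\<bar>g a y\<bar> \<le> \<bar>g a (walk k S)\<bar> + 2 * K * h" by (simp add: shift_def)
    then show ?thesis using h by (simp add: abs_mult)
  qed
  ultimately have "\<bar>f (shift a (2 * h) y) - f y\<bar> \<le> 2 * h * (\<bar>g a (walk k S)\<bar> + 2 * K * h) + K * (2 * h)\<^sup>2"
    by linarith
  also have "\<dots> = h * (2 * \<bar>g a (walk k S)\<bar> + 8 * K * h)"
    by (simp add: power2_eq_square algebra_simps)
  finally show ?thesis by (simp add: bit_diff_def ins flip: y_def)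
qed

lemma sum_cube_bits:
  fixes \<psi> :: "'a \<Rightarrow> real" and k :: nat
  shows "(\<Sum>b\<in>I \<times> {..<k}. \<psi> (fst b)) = k * (\<Sum>a\<in>I. \<psi> a)"
  using sum.cartesian_product[of "\<lambda>a l. \<psi> a" "{..<k}" I]
  by (simp add: case_prod_unfold sum_distrib_left)

text \<open>
  Each of the \<open>k\<close> bits of a coordinate contributes about \<open>4 h\<^sup>2 (g a)\<^sup>2\<close> to the energy and
  the square of \<open>h\<close> times the mean of \<open>\<bar>g a\<bar>\<close> to the influences. As \<open>k h\<^sup>2 = 1\<close>, the sums do not depend on
  \<open>k\<close> up to errors that vanish with \<open>h\<close>.
\<close>

lemma walk_variance_bound:
  fixes h :: real
  assumes I: "finite I" and g: "has_gradient_on I I K f g"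
    and unit: "\<And>x. (\<Sum>a\<in>I. (g a x)\<^sup>2) \<le> 1"
    and "1 \<le> \<tau>" "0 < k"
    and influence: "\<tau> * (\<Sum>a\<in>I. (cube_avg (I \<times> {..<k}) (\<lambda>S. \<bar>g a (walk k S)\<bar>))\<^sup>2) \<le> 1"
  defines "h \<equiv> 1 / sqrt k"
  shows "(cube_avg (I \<times> {..<k}) (\<lambda>S. (f (walk k S))\<^sup>2) - (cube_avg (I \<times> {..<k}) (\<lambda>S. f (walk k S)))\<^sup>2) * (1 + ln \<tau>)
    \<le> 5 + (1 + \<tau>) * (card I * (32 * K * h + 64 * K\<^sup>2 * h\<^sup>2))"
proof -
  define B where "B = I \<times> {..<k}"
  define e where "e = 32 * K * h + 64 * K\<^sup>2 * h\<^sup>2"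
  define v where "v a = cube_avg B (\<lambda>S. \<bar>g a (walk k S)\<bar>)" for a
  let ?\<Delta> = "\<lambda>b S. bit_diff b (\<lambda>S. f (walk k S)) S"
  have B: "finite B" using I by (simp add: B_def)
  have K: "0 \<le> K" using g by (simp add: has_gradient_on_def)
  have h: "0 < h" "k * h\<^sup>2 = 1" using \<open>0 < k\<close> by (simp_all add: h_def power_divide)
  have e: "0 \<le> e" using K h by (simp add: e_def)
  have g_le_1: "\<bar>g a x\<bar> \<le> 1" if "a \<in> I" for a x
  proof -
    have "(g a x)\<^sup>2 \<le> (\<Sum>a\<in>I. (g a x)\<^sup>2)" using that I by (intro member_le_sum) auto
    then show ?thesis using unit[of x] abs_square_le_1[of "g a x"] by linarith
  qed
  have v: "0 \<le> v a" "v a \<le> 1" if "a \<in> I" for a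
  proof -
    show "0 \<le> v a" by (simp add: v_def cube_avg_nonneg)
    have "v a \<le> cube_avg B (\<lambda>_. 1)" unfolding v_def by (intro cube_avg_mono g_le_1 that)
    then show "v a \<le> 1" using B by (simp add: cube_avg_const)
  qed
  have energy: "cube_avg B (\<lambda>S. (?\<Delta> b S)\<^sup>2) \<le> h\<^sup>2 * (4 * cube_avg B (\<lambda>S. (g (fst b) (walk k S))\<^sup>2) + e)"
    if "b \<in> B" for b
  proof -
    obtain a l where b: "b = (a, l)" "a \<in> I" "l < k" using \<open>b \<in> B\<close> by (auto simp: B_def)
    have "(?\<Delta> b S)\<^sup>2 \<le> h\<^sup>2 * (4 * (g a (walk k S))\<^sup>2 + e)" for S
    proof -
      define u where "u = \<bar>g a (walk k S)\<bar>"
      have u: "0 \<le> u" "u \<le> 1" using g_le_1[OF b(2)] by (auto simp: u_def)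
      have "\<bar>?\<Delta> b S\<bar> \<le> h * (2 * u + 8 * K * h)"
        using bit_diff_walk_le[OF I b(2) g b(3), of S] by (simp add: b u_def h_def)
      then have "(?\<Delta> b S)\<^sup>2 \<le> (h * (2 * u + 8 * K * h))\<^sup>2"
        using h K u by (metis abs_ge_zero power2_abs power_mono)
      also have "\<dots> = h\<^sup>2 * (4 * u\<^sup>2 + (32 * K * h) * u + 64 * K\<^sup>2 * h\<^sup>2)"
        by (simp add: power2_eq_square algebra_simps)
      also have "\<dots> \<le> h\<^sup>2 * (4 * u\<^sup>2 + e)"
      proof (rule mult_left_mono)
        have "(32 * K * h) * u \<le> (32 * K * h) * 1" using K h u by (intro mult_left_mono) auto
        then show "4 * u\<^sup>2 + (32 * K * h) * u + 64 * K\<^sup>2 * h\<^sup>2 \<le> 4 * u\<^sup>2 + e" by (simp add: e_def)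
      qed simp
      finally show ?thesis by (simp add: u_def)
    qed
    then have "cube_avg B (\<lambda>S. (?\<Delta> b S)\<^sup>2) \<le> cube_avg B (\<lambda>S. h\<^sup>2 * (4 * (g a (walk k S))\<^sup>2 + e))"
      by (intro cube_avg_mono)
    also have "\<dots> = h\<^sup>2 * (4 * cube_avg B (\<lambda>S. (g a (walk k S))\<^sup>2) + e)"
      using B by (simp only: cube_avg_cmult cube_avg_add cube_avg_const)
    finally show ?thesis by (simp add: b)
  qed
  have "(\<Sum>b\<in>B. cube_avg B (\<lambda>S. (?\<Delta> b S)\<^sup>2))
      \<le> (\<Sum>b\<in>B. h\<^sup>2 * (4 * cube_avg B (\<lambda>S. (g (fst b) (walk k S))\<^sup>2) + e))"
    by (intro sum_mono energy)
  also have "\<dots> = k * (\<Sum>a\<in>I. h\<^sup>2 * (4 * cube_avg B (\<lambda>S. (g a (walk k S))\<^sup>2) + e))"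
    unfolding B_def by (rule sum_cube_bits)
  also have "\<dots> = (k * h\<^sup>2) * (\<Sum>a\<in>I. 4 * cube_avg B (\<lambda>S. (g a (walk k S))\<^sup>2) + e)"
    by (simp add: sum_distrib_left mult.assoc)
  also have "\<dots> = 4 * cube_avg B (\<lambda>S. \<Sum>a\<in>I. (g a (walk k S))\<^sup>2) + card I * e"
    by (simp add: h sum.distrib cube_avg_sum sum_distrib_left)
  also have "\<dots> \<le> 4 * cube_avg B (\<lambda>_. 1) + card I * e"
    by (intro add_mono mult_left_mono cube_avg_mono unit) auto
  finally have total_energy: "(\<Sum>b\<in>B. cube_avg B (\<lambda>S. (?\<Delta> b S)\<^sup>2)) \<le> 4 + card I * e"
    using B by (simp add: cube_avg_const)
  have single: "(cube_avg B (\<lambda>S. \<bar>?\<Delta> b S\<bar>) / 2)\<^sup>2 \<le> h\<^sup>2 * ((v (fst b))\<^sup>2 + e)" if "b \<in> B" for b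
  proof -
    obtain a l where b: "b = (a, l)" "a \<in> I" "l < k" using \<open>b \<in> B\<close> by (auto simp: B_def)
    have "\<bar>?\<Delta> b S\<bar> \<le> h * (2 * \<bar>g a (walk k S)\<bar> + 8 * K * h)" for S
      using bit_diff_walk_le[OF I b(2) g b(3), of S] by (simp add: b h_def)
    then have "cube_avg B (\<lambda>S. \<bar>?\<Delta> b S\<bar>) \<le> cube_avg B (\<lambda>S. h * (2 * \<bar>g a (walk k S)\<bar> + 8 * K * h))"
      by (intro cube_avg_mono)
    also have "\<dots> = h * (2 * v a + 8 * K * h)"
      using B by (simp only: cube_avg_cmult cube_avg_add cube_avg_const v_def)
    finally have "cube_avg B (\<lambda>S. \<bar>?\<Delta> b S\<bar>) / 2 \<le> h * (v a + 4 * K * h)" by (simp add: algebra_simps)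
    then have "(cube_avg B (\<lambda>S. \<bar>?\<Delta> b S\<bar>) / 2)\<^sup>2 \<le> (h * (v a + 4 * K * h))\<^sup>2"
      by (intro power_mono) (auto intro!: cube_avg_nonneg)
    also have "\<dots> = h\<^sup>2 * ((v a)\<^sup>2 + (8 * K * h) * v a + 16 * K\<^sup>2 * h\<^sup>2)"
      by (simp add: power2_eq_square algebra_simps)
    also have "\<dots> \<le> h\<^sup>2 * ((v a)\<^sup>2 + e)"
    proof (rule mult_left_mono)
      have "(8 * K * h) * v a \<le> (8 * K * h) * 1" using K h v[OF b(2)] by (intro mult_left_mono) auto
      moreover have "0 \<le> K * h" "0 \<le> K\<^sup>2 * h\<^sup>2" using K h by auto
      ultimately show "(v a)\<^sup>2 + (8 * K * h) * v a + 16 * K\<^sup>2 * h\<^sup>2 \<le> (v a)\<^sup>2 + e"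
        unfolding e_def by linarith
    qed simp
    finally show ?thesis by (simp add: b)
  qed
  have "(\<Sum>b\<in>B. (cube_avg B (\<lambda>S. \<bar>?\<Delta> b S\<bar>) / 2)\<^sup>2) \<le> (\<Sum>b\<in>B. h\<^sup>2 * ((v (fst b))\<^sup>2 + e))"
    by (intro sum_mono single)
  also have "\<dots> = k * (\<Sum>a\<in>I. h\<^sup>2 * ((v a)\<^sup>2 + e))"
    unfolding B_def by (rule sum_cube_bits)
  also have "\<dots> = (k * h\<^sup>2) * (\<Sum>a\<in>I. (v a)\<^sup>2 + e)"
    by (simp add: sum_distrib_left mult.assoc)
  also have "\<dots> = (\<Sum>a\<in>I. (v a)\<^sup>2) + card I * e"
    by (simp add: h sum.distrib)
  finally have "\<tau> * (\<Sum>b\<in>B. (cube_avg B (\<lambda>S. \<bar>?\<Delta> b S\<bar>) / 2)\<^sup>2) \<le> \<tau> * ((\<Sum>a\<in>I. (v a)\<^sup>2) + card I * e)"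
    using \<open>1 \<le> \<tau>\<close> by (intro mult_left_mono) auto
  also have "\<dots> \<le> 1 + \<tau> * (card I * e)"
    using influence by (simp add: v_def B_def distrib_left)
  finally show ?thesis
    using cube_variance_bound[OF B \<open>1 \<le> \<tau>\<close>, of "\<lambda>S. f (walk k S)"] total_energy
    by (simp add: B_def e_def distrib_right)
qed

lemma gaussian_variance_smooth:
  fixes f :: "('a::countable \<Rightarrow> real) \<Rightarrow> real"
  assumes I: "finite I" and f: "l1_lipschitz I L f" and bound: "\<And>x. \<bar>f x\<bar> \<le> R"
    and g: "has_gradient_on I I K f g"
    and unit: "\<And>x. (\<Sum>a\<in>I. (g a x)\<^sup>2) \<le> 1"
    and "1 \<le> \<tau>"
    and influence: "\<And>k. \<tau> * (\<Sum>a\<in>I. (cube_avg (I \<times> {..<k}) (\<lambda>S. \<bar>g a (walk k S)\<bar>))\<^sup>2) \<le> 1"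
  defines "\<gamma> \<equiv> Pi\<^sub>M I (\<lambda>_. std_normal_distribution)"
  shows "((\<integral>x. (f x)\<^sup>2 \<partial>\<gamma>) - (\<integral>x. f x \<partial>\<gamma>)\<^sup>2) * (1 + ln \<tau>) \<le> 5"
proof -
  have R: "0 \<le> R" using bound[of undefined] by linarith
  have f2: "l1_lipschitz I (2 * R * L) (\<lambda>x. (f x)\<^sup>2)"
    unfolding l1_lipschitz_def
  proof (intro allI)
    fix x y
    have "\<bar>(f x)\<^sup>2 - (f y)\<^sup>2\<bar> = \<bar>f x + f y\<bar> * \<bar>f x - f y\<bar>"
      by (simp add: power2_eq_square algebra_simps flip: abs_mult)
    also have "\<dots> \<le> (2 * R) * (L * (\<Sum>b\<in>I. \<bar>x b - y b\<bar>))"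
      using f bound[of x] bound[of y] R unfolding l1_lipschitz_def by (intro mult_mono) auto
    finally show "\<bar>(f x)\<^sup>2 - (f y)\<^sup>2\<bar> \<le> 2 * R * L * (\<Sum>b\<in>I. \<bar>x b - y b\<bar>)" by (simp add: mult.assoc)
  qed
  have bound2: "\<bar>(f x)\<^sup>2\<bar> \<le> R\<^sup>2" for x
    using power_mono[OF bound[of x], of 2] by simp
  let ?B = "\<lambda>k. I \<times> {..<k}"
  have "(\<lambda>k. (cube_avg (?B k) (\<lambda>S. (f (walk k S))\<^sup>2) - (cube_avg (?B k) (\<lambda>S. f (walk k S)))\<^sup>2) * (1 + ln \<tau>))
      \<longlonglongrightarrow> ((\<integral>x. (f x)\<^sup>2 \<partial>\<gamma>) - (\<integral>x. f x \<partial>\<gamma>)\<^sup>2) * (1 + ln \<tau>)"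
    unfolding \<gamma>_def
    by (intro tendsto_intros walk_CLT_product[OF I f bound] walk_CLT_product[OF I f2 bound2])
  moreover have "(\<lambda>k. 5 + (1 + \<tau>) * (card I * (32 * K * (1 / sqrt k) + 64 * K\<^sup>2 * (1 / sqrt k)\<^sup>2))) \<longlonglongrightarrow> 5"
    by real_asymp
  moreover have "eventually (\<lambda>k. (cube_avg (?B k) (\<lambda>S. (f (walk k S))\<^sup>2) - (cube_avg (?B k) (\<lambda>S. f (walk k S)))\<^sup>2) * (1 + ln \<tau>)
      \<le> 5 + (1 + \<tau>) * (card I * (32 * K * (1 / sqrt k) + 64 * K\<^sup>2 * (1 / sqrt k)\<^sup>2))) sequentially"
    using eventually_gt_at_top[of 0]
    by eventually_elim (rule walk_variance_bound[OF I g unit \<open>1 \<le> \<tau>\<close> _ influence])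
  ultimately show ?thesis
    by (intro tendsto_le[OF sequentially_bot]) auto
qed

text \<open>
  Permuting the coordinates of the walk amounts to permuting the bits, which preserves the average.
\<close>

lemma cube_avg_walk_permute:
  assumes "finite I" "bij p" "p ` I = I"
  shows "cube_avg (I \<times> {..<k}) (\<lambda>S. \<phi> (walk k S \<circ> p)) = cube_avg (I \<times> {..<k}) (\<lambda>S. \<phi> (walk k S))"
proof -
  define \<beta> where "\<beta> = (\<lambda>(a, l::nat). (p a, l))"
  have "inj_on \<beta> (I \<times> {..<k})"
    using bij_is_inj[OF assms(2)] by (auto simp: \<beta>_def inj_on_def inj_def)
  moreover have "\<beta> ` (I \<times> {..<k}) = p ` I \<times> {..<k}"
    by (force simp: \<beta>_def)
  ultimately have "bij_betw \<beta> (I \<times> {..<k}) (I \<times> {..<k})"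
    by (simp add: bij_betw_def assms(3))
  then have "bij_betw ((`) \<beta>) (Pow (I \<times> {..<k})) (Pow (I \<times> {..<k}))"
    by (rule bij_betw_Pow)
  then have "(\<Sum>S\<in>Pow (I \<times> {..<k}). \<phi> (walk k S \<circ> p)) = (\<Sum>S\<in>Pow (I \<times> {..<k}). \<phi> (walk k (\<beta> ` S) \<circ> p))"
    by (rule sum.reindex_bij_betw[symmetric])
  moreover have "walk k (\<beta> ` S) \<circ> p = walk k S" for S
  proof
    fix a
    have "{l. (p a, l) \<in> \<beta> ` S} = {l. (a, l) \<in> S}"
      using bij_is_inj[OF assms(2)] by (force simp: \<beta>_def inj_def image_iff)
    then show "(walk k (\<beta> ` S) \<circ> p) a = walk k S a" by (simp add: walk_def)
  qed
  ultimately show ?thesis by (simp add: cube_avg_def)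
qed

section \<open>Functions of a Gaussian matrix that are symmetric in the rows\<close>

abbreviation cells :: "nat \<Rightarrow> nat \<Rightarrow> (nat \<times> nat) set"
  where "cells M N \<equiv> {..<M} \<times> {..<N}"

text \<open>
  The two bounds on increments that the margin satisfies, with \<open>\<theta> = 1 / q\<close>. For \<open>\<theta> < 1 / 2\<close> and \<open>M > 1\<close> the
  second is better than the first along directions that move all rows by the same nonzero length.
\<close>

definition row_lipschitz :: "nat \<Rightarrow> nat \<Rightarrow> real \<Rightarrow> ((nat \<times> nat \<Rightarrow> real) \<Rightarrow> real) \<Rightarrow> bool"
  where "row_lipschitz M N \<theta> f \<longleftrightarrow>
    (\<forall>x H. \<bar>f (\<lambda>a. x a + H a) - f x\<bar> \<le> L2_set H (cells M N)) \<and>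
    (\<forall>x H r. (\<forall>i<M. L2_set (\<lambda>j. H (i, j)) {..<N} \<le> r) \<longrightarrow>
      \<bar>f (\<lambda>a. x a + H a) - f x\<bar> \<le> M powr \<theta> * r)"

lemma row_lipschitzD:
  assumes "row_lipschitz M N \<theta> f"
  shows "\<bar>f (\<lambda>a. x a + H a) - f x\<bar> \<le> L2_set H (cells M N)"
    and "(\<And>i. i < M \<Longrightarrow> L2_set (\<lambda>j. H (i, j)) {..<N} \<le> r) \<Longrightarrow>
      \<bar>f (\<lambda>a. x a + H a) - f x\<bar> \<le> M powr \<theta> * r"
  using assms by (auto simp: row_lipschitz_def)

lemma row_lipschitz_inherited:
  "row_lipschitz M N \<theta> f \<Longrightarrow> increment_bounds_inherited f f' \<Longrightarrow> row_lipschitz M N \<theta> f'"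
  unfolding row_lipschitz_def increment_bounds_inherited_def by blast

lemma row_lipschitz_l1:
  assumes "row_lipschitz M N \<theta> f"
  shows "l1_lipschitz (cells M N) 1 f"
  unfolding l1_lipschitz_def
proof (intro allI)
  fix x y
  have "\<bar>f x - f y\<bar> \<le> L2_set (\<lambda>a. x a - y a) (cells M N)"
    using row_lipschitzD(1)[OF assms, of y "\<lambda>a. x a - y a"] by simp
  also have "\<dots> \<le> (\<Sum>b\<in>cells M N. \<bar>x b - y b\<bar>)" by (rule L2_set_le_sum_abs)
  finally show "\<bar>f x - f y\<bar> \<le> 1 * (\<Sum>b\<in>cells M N. \<bar>x b - y b\<bar>)" by simp
qed

definition row_perms :: "nat \<Rightarrow> (nat \<times> nat \<Rightarrow> nat \<times> nat) set"
  where "row_perms M = (\<lambda>\<pi> (i, j). (\<pi> i, j)) ` {\<pi>. \<pi> permutes {..<M}}"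

lemma row_perms_finite: "finite (row_perms M)"
  by (simp add: row_perms_def finite_permutations)

lemma row_perms_nonempty: "row_perms M \<noteq> {}"
  using permutes_id unfolding row_perms_def by blast

lemma row_perms_bij:
  assumes "p \<in> row_perms M"
  shows "bij p"
proof -
  obtain \<pi> where "\<pi> permutes {..<M}" and p: "p = (\<lambda>(i, j). (\<pi> i, j))"
    using assms by (auto simp: row_perms_def)
  then have "bij \<pi>" by (simp add: permutes_bij)
  then show ?thesis
    unfolding p by (intro o_bij[of "\<lambda>(i, j). (inv \<pi> i, j)"]) (auto simp: fun_eq_iff bij_is_inj bij_is_surj surj_f_inv_f)
qed

lemma row_perms_cells:
  assumes "p \<in> row_perms M"
  shows "p ` cells M N = cells M N"
proof -
  obtain \<pi> where \<pi>: "\<pi> permutes {..<M}" and p: "p = (\<lambda>(i, j). (\<pi> i, j))"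
    using assms by (auto simp: row_perms_def)
  have "p ` cells M N = \<pi> ` {..<M} \<times> {..<N}" unfolding p by force
  then show ?thesis using \<pi> by (simp add: permutes_image)
qed

lemma row_perms_translate:
  assumes "p \<in> row_perms M"
  shows "bij_betw (\<lambda>r. p \<circ> r) (row_perms M) (row_perms M)"
proof -
  have inj: "inj_on (\<lambda>r. p \<circ> r) (row_perms M)"
    by (rule inj_on_subset[OF fun.inj_map[OF bij_is_inj[OF row_perms_bij[OF assms]]] subset_UNIV])
  have "(\<lambda>r. p \<circ> r) ` row_perms M \<subseteq> row_perms M"
  proof safe
    fix r assume "r \<in> row_perms M"
    with assms obtain \<pi> \<rho> where "\<pi> permutes {..<M}" "\<rho> permutes {..<M}"
      "p = (\<lambda>(i, j). (\<pi> i, j))" "r = (\<lambda>(i, j). (\<rho> i, j))"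
      by (auto simp: row_perms_def)
    then show "p \<circ> r \<in> row_perms M"
      unfolding row_perms_def by (intro image_eqI[of _ _ "\<pi> \<circ> \<rho>"]) (auto simp: permutes_compose)
  qed
  then show ?thesis
    using inj row_perms_finite[of M] by (simp add: bij_betw_def endo_inj_surj)
qed

lemma L2_set_cells_permute:
  assumes "p \<in> row_perms M"
  shows "L2_set (H \<circ> p) (cells M N) = L2_set H (cells M N)"
proof -
  have "bij_betw p (cells M N) (cells M N)"
    using row_perms_bij[OF assms] row_perms_cells[OF assms]
    by (simp add: bij_betw_def inj_on_subset[OF bij_is_inj])
  from sum.reindex_bij_betw[OF this, of "\<lambda>a. (H a)\<^sup>2"] show ?thesis
    by (simp add: L2_set_def)
qed

lemma row_lipschitz_symmetrise:
  assumes f: "row_lipschitz M N \<theta> f"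
  shows "row_lipschitz M N \<theta> (symmetrise (row_perms M) f)"
proof -
  have bound: "\<bar>symmetrise (row_perms M) f (\<lambda>a. x a + H a) - symmetrise (row_perms M) f x\<bar> \<le> c"
    if each: "\<And>p. p \<in> row_perms M \<Longrightarrow> \<bar>f (\<lambda>a. (x \<circ> p) a + (H \<circ> p) a) - f (x \<circ> p)\<bar> \<le> c" for x H c
  proof -
    have "\<bar>f ((\<lambda>a. x a + H a) \<circ> p) - f (x \<circ> p)\<bar> \<le> c" if "p \<in> row_perms M" for p
      using each[OF that] by (simp add: comp_def)
    from abs_average_le[OF row_perms_finite row_perms_nonempty this] show ?thesis
      by (simp add: symmetrise_def sum_subtractf diff_divide_distrib)
  qed
  show ?thesis
    unfolding row_lipschitz_def
  proof (intro conjI allI impI bound)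
    fix x H p assume "p \<in> row_perms M"
    then show "\<bar>f (\<lambda>a. (x \<circ> p) a + (H \<circ> p) a) - f (x \<circ> p)\<bar> \<le> L2_set H (cells M N)"
      using row_lipschitzD(1)[OF f, of "x \<circ> p" "H \<circ> p"] by (simp add: L2_set_cells_permute)
  next
    fix x H r p
    assume H: "\<forall>i<M. L2_set (\<lambda>j. H (i, j)) {..<N} \<le> r" and "p \<in> row_perms M"
    then obtain \<pi> where \<pi>: "\<pi> permutes {..<M}" and p: "p = (\<lambda>(i, j). (\<pi> i, j))"
      by (auto simp: row_perms_def)
    show "\<bar>f (\<lambda>a. (x \<circ> p) a + (H \<circ> p) a) - f (x \<circ> p)\<bar> \<le> M powr \<theta> * r"
    proof (rule row_lipschitzD(2)[OF f])
      fix i assume "i < M"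
      then have "\<pi> i < M" using permutes_in_image[OF \<pi>, of i] by simp
      then show "L2_set (\<lambda>j. (H \<circ> p) (i, j)) {..<N} \<le> r" using H by (simp add: p)
    qed
  qed
qed

text \<open>
  Let \<open>v a\<close> be the mean of \<open>\<bar>g a\<bar>\<close>. By symmetry it depends only on the column, so all rows of \<open>v\<close>
  have the same length \<open>r\<close>. Pairing the gradient with the matrix that has entries \<open>\<plusminus>v a\<close>, with the signs
  of the gradient, gives \<open>\<Sum>v\<^sup>2 \<le> M\<^sup>\<theta> r\<close> after averaging. The left-hand side is \<open>M r\<^sup>2\<close>,
  hence \<open>r \<le> M\<^sup>\<theta>\<^sup>-\<^sup>1\<close> and \<open>\<Sum>v\<^sup>2 \<le> M\<^sup>2\<^sup>\<theta>\<^sup>-\<^sup>1\<close>. Pairing the gradient with itself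
  shows that its length is at most \<open>1\<close>.
\<close>

lemma gaussian_variance_smooth_symmetric:
  assumes "1 \<le> M" and \<theta>: "\<theta> \<le> 1 / 2"
    and f: "row_lipschitz M N \<theta> f" and bound: "\<And>x. \<bar>f x\<bar> \<le> R"
    and g: "has_gradient_on (cells M N) (cells M N) K f g"
    and equivariant: "\<And>p a x. p \<in> row_perms M \<Longrightarrow> g (p a) x = g a (x \<circ> p)"
  defines "\<gamma> \<equiv> Pi\<^sub>M (cells M N) (\<lambda>_. std_normal_distribution)"
  shows "((\<integral>x. (f x)\<^sup>2 \<partial>\<gamma>) - (\<integral>x. f x \<partial>\<gamma>)\<^sup>2) * (1 + (1 - 2 * \<theta>) * ln M) \<le> 5"
proof -
  let ?I = "cells M N"
  have I: "finite ?I" by simp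
  have lip: "l1_lipschitz ?I 1 f" by (rule row_lipschitz_l1[OF f])
  have unit: "(\<Sum>a\<in>?I. (g a x)\<^sup>2) \<le> 1" for x
  proof -
    define s where "s = (\<Sum>a\<in>?I. (g a x)\<^sup>2)"
    have "(\<Sum>a\<in>?I. g a x * g a x) \<le> L2_set (\<lambda>a. g a x) ?I"
    proof (rule gradient_pairing_le[OF I lip g])
      fix t :: real assume "0 < t"
      then show "\<bar>f (\<lambda>a. x a + t * g a x) - f x\<bar> \<le> t * L2_set (\<lambda>a. g a x) ?I"
        using row_lipschitzD(1)[OF f, of x "\<lambda>a. t * g a x"] by (simp add: L2_set_right_distrib)
    qed
    then have "s \<le> sqrt s" by (simp add: s_def L2_set_def power2_eq_square)
    moreover have "0 \<le> s" by (simp add: s_def sum_nonneg)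
    ultimately have "sqrt s * sqrt s \<le> sqrt s * 1" by simp
    then have "s \<le> 1"
      using mult_left_le_imp_le[of "sqrt s" "sqrt s" 1] \<open>0 \<le> s\<close> by (cases "s = 0") auto
    then show ?thesis by (simp add: s_def)
  qed
  \<comment> \<open>With this value the influences contribute at most \<open>1\<close> to the bound on the variance.\<close>
  define \<tau> where "\<tau> = M powr (1 - 2 * \<theta>)"
  have \<tau>: "1 \<le> \<tau>" unfolding \<tau>_def using \<open>1 \<le> M\<close> \<theta> by (intro ge_one_powr_ge_zero) auto
  have influence: "\<tau> * (\<Sum>a\<in>?I. (cube_avg (?I \<times> {..<k}) (\<lambda>S. \<bar>g a (walk k S)\<bar>))\<^sup>2) \<le> 1" for k
  proof -
    define v where "v a = cube_avg (?I \<times> {..<k}) (\<lambda>S. \<bar>g a (walk k S)\<bar>)" for a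
    define r where "r = L2_set (\<lambda>j. v (0, j)) {..<N}"
    have v_perm: "v (p a) = v a" if "p \<in> row_perms M" for p a
      using cube_avg_walk_permute[OF I row_perms_bij[OF that] row_perms_cells[OF that],
          where \<phi> = "\<lambda>x. \<bar>g a x\<bar>" and k = k]
      by (simp add: v_def equivariant[OF that])
    have v_row: "v (i, j) = v (0, j)" if "i < M" for i j
    proof -
      have "Transposition.transpose 0 i permutes {..<M}"
        using that by (intro permutes_swap_id) auto
      then have "(\<lambda>(i', j). (Transposition.transpose 0 i i', j)) \<in> row_perms M"
        by (auto simp: row_perms_def)
      from v_perm[OF this, of "(0, j)"] show ?thesis by simp
    qed
    have pairing: "(\<Sum>a\<in>?I. v a * \<bar>g a x\<bar>) \<le> M powr \<theta> * r" for x
    proof -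
      define H where "H a = (if 0 \<le> g a x then v a else - v a)" for a
      have "(\<Sum>a\<in>?I. H a * g a x) \<le> M powr \<theta> * r"
      proof (rule gradient_pairing_le[OF I lip g])
        fix t :: real assume t: "0 < t"
        have "L2_set (\<lambda>j. t * H (i, j)) {..<N} = t * r" if "i < M" for i
        proof -
          have "(H (i, j))\<^sup>2 = (v (0, j))\<^sup>2" for j using v_row[OF that, of j] by (simp add: H_def)
          then have "L2_set (\<lambda>j. H (i, j)) {..<N} = r" by (simp add: L2_set_def r_def)
          then show ?thesis using t L2_set_right_distrib[of t "\<lambda>j. H (i, j)" "{..<N}"] by simp
        qed
        then have "\<bar>f (\<lambda>a. x a + t * H a) - f x\<bar> \<le> M powr \<theta> * (t * r)"
          by (intro row_lipschitzD(2)[OF f]) simp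
        then show "\<bar>f (\<lambda>a. x a + t * H a) - f x\<bar> \<le> t * (M powr \<theta> * r)" by (simp add: mult_ac)
      qed
      moreover have "H a * g a x = v a * \<bar>g a x\<bar>" for a by (simp add: H_def abs_if)
      ultimately show ?thesis by simp
    qed
    have "(\<Sum>a\<in>?I. (v a)\<^sup>2) = cube_avg (?I \<times> {..<k}) (\<lambda>S. \<Sum>a\<in>?I. v a * \<bar>g a (walk k S)\<bar>)"
      by (simp add: cube_avg_sum cube_avg_cmult power2_eq_square flip: v_def)
    also have "\<dots> \<le> cube_avg (?I \<times> {..<k}) (\<lambda>_. M powr \<theta> * r)"
      by (intro cube_avg_mono pairing)
    also have "\<dots> = M powr \<theta> * r" by (simp add: cube_avg_const)
    finally have v_le: "(\<Sum>a\<in>?I. (v a)\<^sup>2) \<le> M powr \<theta> * r" .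
    have v_eq: "(\<Sum>a\<in>?I. (v a)\<^sup>2) = M * r\<^sup>2"
    proof -
      have "(\<Sum>a\<in>?I. (v a)\<^sup>2) = (\<Sum>i<M. \<Sum>j<N. (v (i, j))\<^sup>2)"
        by (simp add: sum.cartesian_product)
      also have "\<dots> = (\<Sum>i<M. \<Sum>j<N. (v (0, j))\<^sup>2)"
        by (intro sum.cong refl) (metis v_row lessThan_iff)
      finally show ?thesis by (simp add: r_def L2_set_def sum_nonneg)
    qed
    have "M powr (1 - \<theta>) * r \<le> 1"
    proof (cases "r = 0")
      case False
      then have "0 < r" by (simp add: r_def less_le L2_set_nonneg)
      have "M * r * r \<le> M powr \<theta> * r" using v_le v_eq by (simp add: power2_eq_square mult.assoc)
      then have "M * r \<le> M powr \<theta>" using \<open>0 < r\<close> by simp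
      then have "M powr - \<theta> * (M * r) \<le> M powr - \<theta> * M powr \<theta>"
        by (intro mult_left_mono) auto
      moreover have "M powr - \<theta> * (M * r) = M powr (1 - \<theta>) * r" "M powr - \<theta> * M powr \<theta> = 1"
        using \<open>1 \<le> M\<close> by (simp_all add: powr_diff powr_minus field_simps)
      ultimately show ?thesis by simp
    qed simp
    then have "(M powr (1 - \<theta>) * r)\<^sup>2 \<le> 1\<^sup>2"
      by (intro power_mono) (auto simp: r_def L2_set_nonneg)
    moreover have "(M powr (1 - \<theta>) * r)\<^sup>2 = \<tau> * (M * r\<^sup>2)"
    proof -
      have "(M powr (1 - \<theta>))\<^sup>2 = M powr (1 - 2 * \<theta>) * M powr 1"
        by (simp only: power2_eq_square powr_add[symmetric]) simp
      then show ?thesis using \<open>1 \<le> M\<close> by (simp add: \<tau>_def power_mult_distrib)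
    qed
    ultimately show ?thesis using v_eq by (simp add: v_def)
  qed
  have "ln \<tau> = (1 - 2 * \<theta>) * ln M" using \<open>1 \<le> M\<close> by (simp add: \<tau>_def ln_powr)
  then show ?thesis
    using gaussian_variance_smooth[OF I lip bound g unit \<tau> influence] by (simp add: \<gamma>_def)
qed

text \<open>
  Clipping makes the function bounded, as the central limit theorem above requires, and smoothing gives
  it a gradient. Clipping comes first because it would destroy smoothness; symmetrising comes last
  because smoothing may destroy the symmetry.
\<close>

lemma clip_approximation:
  fixes f :: "(nat \<times> nat \<Rightarrow> real) \<Rightarrow> real" and R s :: real
  assumes "1 \<le> M" and \<theta>: "\<theta> \<le> 1 / 2"
    and f: "row_lipschitz M N \<theta> f" and sym: "\<And>p x. p \<in> row_perms M \<Longrightarrow> f (x \<circ> p) = f x"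
    and "0 < s"
  defines "\<gamma> \<equiv> Pi\<^sub>M (cells M N) (\<lambda>_. std_normal_distribution)"
  shows "\<exists>F. row_lipschitz M N \<theta> F \<and> (\<forall>x. \<bar>F x - max (- R) (min R (f x))\<bar> \<le> card (cells M N) * s) \<and>
    ((\<integral>x. (F x)\<^sup>2 \<partial>\<gamma>) - (\<integral>x. F x \<partial>\<gamma>)\<^sup>2) * (1 + (1 - 2 * \<theta>) * ln M) \<le> 5"
proof -
  let ?I = "cells M N" and ?P = "row_perms M"
  note P = row_perms_finite row_perms_nonempty row_perms_bij row_perms_cells row_perms_translate
  define c where "c x = max (- R) (min R (f x))" for x
  have c_diff: "\<bar>c x - c y\<bar> \<le> \<bar>f x - f y\<bar>" for x y unfolding c_def by linarith
  have c: "row_lipschitz M N \<theta> c"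
    using f order_trans[OF c_diff] unfolding row_lipschitz_def by blast
  have "\<bar>c x\<bar> \<le> \<bar>R\<bar>" for x unfolding c_def by linarith
  with smoothing_exists[OF _ row_lipschitz_l1[OF c] \<open>0 < s\<close>, of ?I] obtain f' g K where
    f': "increment_bounds_inherited c f'" "\<And>x. \<bar>f' x - c x\<bar> \<le> card ?I * s"
      "\<And>x. \<bar>f' x\<bar> \<le> \<bar>R\<bar>" "has_gradient_on ?I ?I K f' g"
    by (metis finite_SigmaI finite_lessThan order_refl)
  define F where "F = symmetrise ?P f'"
  define G where "G a x = (\<Sum>p\<in>?P. g (inv p a) (x \<circ> p)) / card ?P" for a x
  have F: "row_lipschitz M N \<theta> F"
    unfolding F_def by (intro row_lipschitz_symmetrise row_lipschitz_inherited[OF c f'(1)])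
  have "\<bar>F x\<bar> \<le> \<bar>R\<bar>" for x
    unfolding F_def symmetrise_def by (intro abs_average_le P f'(3))
  moreover have "has_gradient_on ?I ?I K F G"
    unfolding F_def G_def by (rule symmetrise_gradient[OF P f'(4)])
  moreover have "G (p a) x = G a (x \<circ> p)" if "p \<in> ?P" for p a x
    unfolding G_def using symmetrise_gradient_equivariant[OF P that, where g = g and a = a and x = x] by simp
  ultimately have "((\<integral>x. (F x)\<^sup>2 \<partial>\<gamma>) - (\<integral>x. F x \<partial>\<gamma>)\<^sup>2) * (1 + (1 - 2 * \<theta>) * ln M) \<le> 5"
    unfolding \<gamma>_def by (rule gaussian_variance_smooth_symmetric[OF \<open>1 \<le> M\<close> \<theta> F])
  moreover have "\<bar>F x - c x\<bar> \<le> card ?I * s" for x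
  proof -
    have "\<bar>f' (x \<circ> p) - c x\<bar> \<le> card ?I * s" if "p \<in> ?P" for p
      using f'(2)[of "x \<circ> p"] sym[OF that, of x] by (simp add: c_def)
    from abs_average_le[OF P(1,2) this] have "\<bar>(\<Sum>p\<in>?P. f' (x \<circ> p) - c x) / card ?P\<bar> \<le> card ?I * s" .
    moreover have "(\<Sum>p\<in>?P. f' (x \<circ> p) - c x) / card ?P = F x - c x"
      using P(1,2)[of M] by (simp add: F_def symmetrise_def sum_subtractf diff_divide_distrib)
    ultimately show ?thesis by simp
  qed
  ultimately show ?thesis using F unfolding c_def by blast
qed

lemma integrable_coordinate_square:
  fixes I :: "'a set"
  assumes "a \<in> I"
  shows "integrable (Pi\<^sub>M I (\<lambda>_. std_normal_distribution)) (\<lambda>x. (x a)\<^sup>2)"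
proof -
  have "integrable std_normal_distribution (\<lambda>x. x\<^sup>2)"
    using integrable_std_normal_distribution_moment[of 2] by simp
  moreover have "distr (Pi\<^sub>M I (\<lambda>_. std_normal_distribution)) std_normal_distribution (\<lambda>x. x a) = std_normal_distribution"
    using assms by (intro distr_PiM_component prob_space_normal_density) auto
  ultimately have "integrable (distr (Pi\<^sub>M I (\<lambda>_. std_normal_distribution)) std_normal_distribution (\<lambda>x. x a)) (\<lambda>x. x\<^sup>2)"
    by simp
  then show ?thesis
    using assms by (subst (asm) integrable_distr_eq) auto
qed

lemma row_lipschitz_measurable:
  assumes "row_lipschitz M N \<theta> f"
  shows "f \<in> borel_measurable (Pi\<^sub>M (cells M N) (\<lambda>_. std_normal_distribution))"
  using l1_lipschitz_measurable[OF row_lipschitz_l1[OF assms]]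
    measurable_cong_sets[OF sets_PiM_cong[of "cells M N" _ "\<lambda>_. std_normal_distribution" "\<lambda>_. borel"] refl]
  by simp

lemma row_lipschitz_integrable_square:
  assumes "row_lipschitz M N \<theta> f"
  shows "integrable (Pi\<^sub>M (cells M N) (\<lambda>_. std_normal_distribution)) (\<lambda>x. (f x)\<^sup>2)"
proof (rule Bochner_Integration.integrable_bound)
  let ?\<gamma> = "Pi\<^sub>M (cells M N) (\<lambda>_. std_normal_distribution)"
  interpret prob_space ?\<gamma>
    by (intro prob_space_PiM prob_space_normal_density) simp
  define f0 where "f0 = f (\<lambda>_. 0)"
  show "integrable ?\<gamma> (\<lambda>x. 2 * f0\<^sup>2 + 2 * (\<Sum>a\<in>cells M N. (x a)\<^sup>2))"
    by (intro Bochner_Integration.integrable_add integrable_const integrable_mult_right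
        Bochner_Integration.integrable_sum integrable_coordinate_square)
  show "AE x in ?\<gamma>. norm ((f x)\<^sup>2) \<le> norm (2 * f0\<^sup>2 + 2 * (\<Sum>a\<in>cells M N. (x a)\<^sup>2))"
  proof (rule AE_I2)
    fix x
    have "\<bar>f x - f0\<bar> \<le> L2_set x (cells M N)"
      using row_lipschitzD(1)[OF assms, of "\<lambda>_. 0" x] by (simp add: f0_def)
    then have "(f x - f0)\<^sup>2 \<le> (L2_set x (cells M N))\<^sup>2"
      by (metis abs_ge_zero power2_abs power_mono)
    also have "\<dots> = (\<Sum>a\<in>cells M N. (x a)\<^sup>2)"
      by (simp add: L2_set_def sum_nonneg)
    finally have "(f x - f0)\<^sup>2 \<le> (\<Sum>a\<in>cells M N. (x a)\<^sup>2)" .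
    moreover have "(f x)\<^sup>2 \<le> 2 * f0\<^sup>2 + 2 * (f x - f0)\<^sup>2"
      using zero_le_power2[of "f x - 2 * f0"] by (simp add: power2_eq_square algebra_simps)
    ultimately show "norm ((f x)\<^sup>2) \<le> norm (2 * f0\<^sup>2 + 2 * (\<Sum>a\<in>cells M N. (x a)\<^sup>2))"
      by simp
  qed
  show "(\<lambda>x. (f x)\<^sup>2) \<in> borel_measurable ?\<gamma>"
    using row_lipschitz_measurable[OF assms] by measurable
qed

text \<open>
  The approximations at clipping level \<open>n\<close> and smoothing scale \<open>1 / (n + 1)\<close> converge pointwise to \<open>f\<close> and are
  dominated by \<open>\<bar>f\<bar>\<close> plus a constant, so their variances converge to that of \<open>f\<close>.
\<close>

lemma gaussian_variance_row_symmetric: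
  assumes M: "1 \<le> M" and \<theta>: "\<theta> \<le> 1 / 2"
    and f: "row_lipschitz M N \<theta> f" and sym: "\<And>p x. p \<in> row_perms M \<Longrightarrow> f (x \<circ> p) = f x"
  defines "\<gamma> \<equiv> Pi\<^sub>M (cells M N) (\<lambda>_. std_normal_distribution)"
  shows "integrable \<gamma> f" and "integrable \<gamma> (\<lambda>x. (f x)\<^sup>2)"
    and "prob_space.variance \<gamma> f \<le> 5 / (1 + (1 - 2 * \<theta>) * ln M)"
proof -
  interpret prob_space \<gamma>
    unfolding \<gamma>_def by (intro prob_space_PiM prob_space_normal_density) simp
  have meas: "h \<in> borel_measurable \<gamma>" if "row_lipschitz M N \<theta> h" for h
    unfolding \<gamma>_def using that by (rule row_lipschitz_measurable)
  note [measurable] = meas[OF f]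
  show f2: "integrable \<gamma> (\<lambda>x. (f x)\<^sup>2)"
    unfolding \<gamma>_def by (rule row_lipschitz_integrable_square[OF f])
  then show f1: "integrable \<gamma> f"
    by (rule square_integrable_imp_integrable[rotated]) simp
  define m where "m = real (card (cells M N))"
  have m: "0 \<le> m" by (simp add: m_def)
  have "\<exists>F. row_lipschitz M N \<theta> F \<and>
      (\<forall>x. \<bar>F x - max (- real n) (min (real n) (f x))\<bar> \<le> m * (1 / Suc n)) \<and>
      ((\<integral>x. (F x)\<^sup>2 \<partial>\<gamma>) - (\<integral>x. F x \<partial>\<gamma>)\<^sup>2) * (1 + (1 - 2 * \<theta>) * ln M) \<le> 5" for n
    unfolding \<gamma>_def m_def by (rule clip_approximation[where f = f, OF M \<theta> f sym]) simp_all
  then obtain F where F: "\<And>n. row_lipschitz M N \<theta> (F n)"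
    and close: "\<And>n x. \<bar>F n x - max (- real n) (min (real n) (f x))\<bar> \<le> m * (1 / Suc n)"
    and var: "\<And>n. ((\<integral>x. (F n x)\<^sup>2 \<partial>\<gamma>) - (\<integral>x. F n x \<partial>\<gamma>)\<^sup>2) * (1 + (1 - 2 * \<theta>) * ln M) \<le> 5"
    by metis
  note [measurable] = meas[OF F]
  have conv: "(\<lambda>n. F n x) \<longlonglongrightarrow> f x" for x
  proof -
    have "(\<lambda>n. m * (1 / Suc n)) \<longlonglongrightarrow> 0" by real_asymp
    moreover have "eventually (\<lambda>n. norm (F n x - f x) \<le> m * (1 / Suc n)) sequentially"
      using eventually_ge_at_top[of "nat \<lceil>\<bar>f x\<bar>\<rceil>"]
    proof eventually_elim
      case (elim n)
      then have "max (- real n) (min (real n) (f x)) = f x" by linarith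
      then show ?case using close[of n x] by simp
    qed
    ultimately have "(\<lambda>n. F n x - f x) \<longlonglongrightarrow> 0" by (rule Lim_null_comparison[rotated])
    then show ?thesis by (simp add: LIM_zero_iff)
  qed
  have dominated: "\<bar>F n x\<bar> \<le> \<bar>f x\<bar> + m" for n x
  proof -
    have "m * (1 / Suc n) \<le> m * 1" using m by (intro mult_left_mono) auto
    then show ?thesis using close[of n x] by linarith
  qed
  have "(\<lambda>n. \<integral>x. F n x \<partial>\<gamma>) \<longlonglongrightarrow> (\<integral>x. f x \<partial>\<gamma>)"
    by (rule integral_dominated_convergence[where w = "\<lambda>x. \<bar>f x\<bar> + m"])
      (use f1 conv dominated in auto)
  moreover have "(\<lambda>n. \<integral>x. (F n x)\<^sup>2 \<partial>\<gamma>) \<longlonglongrightarrow> (\<integral>x. (f x)\<^sup>2 \<partial>\<gamma>)"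
  proof (rule integral_dominated_convergence[where w = "\<lambda>x. (f x)\<^sup>2 + 2 * m * \<bar>f x\<bar> + m\<^sup>2"])
    show "integrable \<gamma> (\<lambda>x. (f x)\<^sup>2 + 2 * m * \<bar>f x\<bar> + m\<^sup>2)" using f1 f2 by auto
    show "AE x in \<gamma>. (\<lambda>n. (F n x)\<^sup>2) \<longlonglongrightarrow> (f x)\<^sup>2"
      by (intro AE_I2 tendsto_power conv)
    fix n show "AE x in \<gamma>. norm ((F n x)\<^sup>2) \<le> (f x)\<^sup>2 + 2 * m * \<bar>f x\<bar> + m\<^sup>2"
    proof (rule AE_I2)
      fix x
      have "\<bar>F n x\<bar>\<^sup>2 \<le> (\<bar>f x\<bar> + m)\<^sup>2" by (intro power_mono dominated) auto
      then show "norm ((F n x)\<^sup>2) \<le> (f x)\<^sup>2 + 2 * m * \<bar>f x\<bar> + m\<^sup>2"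
        by (simp add: power2_sum algebra_simps)
    qed
  qed auto
  ultimately have "(\<lambda>n. ((\<integral>x. (F n x)\<^sup>2 \<partial>\<gamma>) - (\<integral>x. F n x \<partial>\<gamma>)\<^sup>2) * (1 + (1 - 2 * \<theta>) * ln M))
      \<longlonglongrightarrow> ((\<integral>x. (f x)\<^sup>2 \<partial>\<gamma>) - (\<integral>x. f x \<partial>\<gamma>)\<^sup>2) * (1 + (1 - 2 * \<theta>) * ln M)"
    by (intro tendsto_intros)
  then have "((\<integral>x. (f x)\<^sup>2 \<partial>\<gamma>) - (\<integral>x. f x \<partial>\<gamma>)\<^sup>2) * (1 + (1 - 2 * \<theta>) * ln M) \<le> 5"
    by (rule LIMSEQ_le_const2) (use var in blast)
  moreover have "0 < 1 + (1 - 2 * \<theta>) * ln M"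
    using M \<theta> by (intro add_pos_nonneg mult_nonneg_nonneg) auto
  ultimately show "variance f \<le> 5 / (1 + (1 - 2 * \<theta>) * ln M)"
    by (simp add: variance_eq[OF f1 f2] pos_le_divide_eq)
qed

section \<open>The \<open>\<ell>\<^sup>q\<close> norms and the margin\<close>

lemma lq_exponent_cases:
  assumes "2 \<le> (q::ereal)"
  obtains "q = \<infinity>" | p where "q = ereal p" "2 \<le> p"
  using assms by (cases q) auto

lemma lq_norm_infinity: "lq_norm \<infinity> m x = (MAX i\<in>{..<m}. \<bar>x i\<bar>)"
  by (simp add: lq_norm_def)

lemma lq_norm_finite: "lq_norm (ereal p) m x = (\<Sum>i<m. \<bar>x i\<bar> powr p) powr (1 / p)"
  by (simp add: lq_norm_def)

lemma lq_norm_nonneg: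
  assumes "1 \<le> m" "2 \<le> q"
  shows "0 \<le> lq_norm q m x"
  using assms(2)
proof (cases rule: lq_exponent_cases)
  case 1
  have "\<bar>x 0\<bar> \<le> (MAX i\<in>{..<m}. \<bar>x i\<bar>)" using assms(1) by (intro Max_ge) auto
  then show ?thesis by (simp add: 1 lq_norm_infinity)
qed (simp add: lq_norm_finite)

lemma lq_norm_mono:
  assumes "1 \<le> m" "2 \<le> q" "\<And>i. i < m \<Longrightarrow> \<bar>x i\<bar> \<le> \<bar>y i\<bar>"
  shows "lq_norm q m x \<le> lq_norm q m y"
  using assms(2)
proof (cases rule: lq_exponent_cases)
  case 1
  have "(MAX i\<in>{..<m}. \<bar>x i\<bar>) \<le> (MAX i\<in>{..<m}. \<bar>y i\<bar>)"
    using assms(1,3) by (intro Max.boundedI) (auto simp: lessThan_empty_iff intro!: Max_ge_iff[THEN iffD2])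
  then show ?thesis by (simp add: 1 lq_norm_infinity)
next
  case (2 p)
  then show ?thesis
    using assms(3) by (auto simp: lq_norm_finite intro!: powr_mono2 sum_mono sum_nonneg)
qed

lemma powr_sum_normalised:
  fixes x :: "nat \<Rightarrow> real"
  assumes "0 < c" "(\<Sum>i<m. \<bar>x i\<bar> powr p) powr (1 / p) \<le> c" "0 < p"
  shows "(\<Sum>i<m. (\<bar>x i\<bar> / c) powr p) \<le> 1"
proof -
  define s where "s = (\<Sum>i<m. \<bar>x i\<bar> powr p)"
  have s: "0 \<le> s" by (simp add: s_def sum_nonneg)
  have "(s powr (1 / p)) powr p \<le> c powr p" using assms by (intro powr_mono2) (auto simp: s_def)
  moreover have "(s powr (1 / p)) powr p = s" using assms(3) s by (simp add: powr_powr)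
  moreover have "(\<Sum>i<m. (\<bar>x i\<bar> / c) powr p) = s / c powr p"
    using assms(1) by (simp add: powr_divide s_def sum_divide_distrib)
  ultimately show ?thesis using assms(1) by simp
qed

text \<open>
  Convexity up to the boundary point \<open>0\<close>, where coordinates of a vector may well lie.
\<close>

lemma convex_on_powr_nonneg:
  fixes p :: real
  assumes "1 \<le> p"
  shows "convex_on {0..} (\<lambda>x. x powr p)"
proof (rule convex_onI)
  fix t x y :: real
  assume t: "0 < t" "t < 1" and xy: "x \<in> {0..}" "y \<in> {0..}"
  have scale: "(s * z) powr p \<le> s * z powr p" if "0 \<le> s" "s \<le> 1" "0 \<le> z" for s z :: real
  proof -
    have "s powr p \<le> s powr 1" using that assms by (intro powr_mono') auto
    then show ?thesis using that by (simp add: powr_mult mult_right_mono)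
  qed
  consider "x = 0" | "y = 0" | "0 < x" "0 < y" using xy by fastforce
  then show "((1 - t) *\<^sub>R x + t *\<^sub>R y) powr p \<le> (1 - t) * x powr p + t * y powr p"
  proof cases
    case 3
    then show ?thesis using convex_onD[OF powr_convex[OF assms], of t x y] t by simp
  qed (use scale[of t y] scale[of "1 - t" x] t xy in auto)
qed simp

text \<open>
  Minkowski's inequality. For finite \<open>q\<close>, convexity of \<open>t \<mapsto> t\<^sup>p\<close> shows that the unit ball
  is convex: \<open>(x + y) / (a + b)\<close> is the convex combination of \<open>x / a\<close> and \<open>y / b\<close> with weights
  \<open>a / (a + b)\<close> and \<open>b / (a + b)\<close>. Taking \<open>a\<close> and \<open>b\<close> slightly above the norms avoids division by \<open>0\<close>.
\<close>

lemma lq_norm_triangle: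
  assumes "1 \<le> m" "2 \<le> q"
  shows "lq_norm q m (\<lambda>i. x i + y i) \<le> lq_norm q m x + lq_norm q m y"
  using assms(2)
proof (cases rule: lq_exponent_cases)
  case 1
  have "\<bar>x i + y i\<bar> \<le> (MAX i\<in>{..<m}. \<bar>x i\<bar>) + (MAX i\<in>{..<m}. \<bar>y i\<bar>)" if "i < m" for i
  proof -
    have "\<bar>x i\<bar> \<le> (MAX i\<in>{..<m}. \<bar>x i\<bar>)" "\<bar>y i\<bar> \<le> (MAX i\<in>{..<m}. \<bar>y i\<bar>)"
      using that by (auto intro!: Max_ge)
    then show ?thesis by linarith
  qed
  then show ?thesis
    using assms(1) by (auto simp: 1 lq_norm_infinity lessThan_empty_iff intro!: Max.boundedI)
next
  case (2 p)
  have le: "lq_norm q m (\<lambda>i. x i + y i) \<le> a + b"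
    if "0 < a" "0 < b" "lq_norm q m x \<le> a" "lq_norm q m y \<le> b" for a b
  proof -
    define t where "t = b / (a + b)"
    have t: "0 \<le> t" "t \<le> 1" "1 - t = a / (a + b)" using that by (auto simp: t_def field_simps)
    have "(\<bar>x i + y i\<bar> / (a + b)) powr p \<le> (1 - t) * (\<bar>x i\<bar> / a) powr p + t * (\<bar>y i\<bar> / b) powr p" for i
    proof -
      have "convex_on {0..} (\<lambda>x. x powr p)" using 2 by (intro convex_on_powr_nonneg) auto
      then have "((1 - t) *\<^sub>R (\<bar>x i\<bar> / a) + t *\<^sub>R (\<bar>y i\<bar> / b)) powr p
          \<le> (1 - t) * (\<bar>x i\<bar> / a) powr p + t * (\<bar>y i\<bar> / b) powr p"
        using t that by (intro convex_onD) auto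
      moreover have "(1 - t) *\<^sub>R (\<bar>x i\<bar> / a) + t *\<^sub>R (\<bar>y i\<bar> / b) = (\<bar>x i\<bar> + \<bar>y i\<bar>) / (a + b)"
        using that unfolding t(3) by (simp add: t_def add_divide_distrib)
      moreover have "(\<bar>x i + y i\<bar> / (a + b)) powr p \<le> ((\<bar>x i\<bar> + \<bar>y i\<bar>) / (a + b)) powr p"
        using that 2 by (intro powr_mono2 divide_right_mono) auto
      ultimately show ?thesis by simp
    qed
    then have "(\<Sum>i<m. (\<bar>x i + y i\<bar> / (a + b)) powr p)
        \<le> (\<Sum>i<m. (1 - t) * (\<bar>x i\<bar> / a) powr p + t * (\<bar>y i\<bar> / b) powr p)"
      by (rule sum_mono)
    also have "\<dots> = (1 - t) * (\<Sum>i<m. (\<bar>x i\<bar> / a) powr p) + t * (\<Sum>i<m. (\<bar>y i\<bar> / b) powr p)"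
      by (simp add: sum.distrib sum_distrib_left)
    also have "\<dots> \<le> (1 - t) * 1 + t * 1"
      using that 2 t by (intro add_mono mult_left_mono powr_sum_normalised) (auto simp: lq_norm_finite)
    finally have *: "(\<Sum>i<m. (\<bar>x i + y i\<bar> / (a + b)) powr p) \<le> 1" by simp
    define s where "s = (\<Sum>i<m. \<bar>x i + y i\<bar> powr p)"
    have "s \<le> (a + b) powr p"
      using * that by (simp add: powr_divide s_def field_simps flip: sum_divide_distrib)
    then have "s powr (1 / p) \<le> ((a + b) powr p) powr (1 / p)"
      using 2 by (intro powr_mono2) (auto simp: s_def sum_nonneg)
    also have "\<dots> = a + b" using that 2 by (simp add: powr_powr)
    finally show ?thesis by (simp add: 2 lq_norm_finite s_def)
  qed
  show ?thesis
  proof (rule field_le_epsilon)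
    fix e :: real assume "0 < e"
    then have "lq_norm q m (\<lambda>i. x i + y i) \<le> (lq_norm q m x + e / 2) + (lq_norm q m y + e / 2)"
      using lq_norm_nonneg[OF assms, of x] lq_norm_nonneg[OF assms, of y] by (intro le) auto
    then show "lq_norm q m (\<lambda>i. x i + y i) \<le> lq_norm q m x + lq_norm q m y + e" by simp
  qed
qed

lemma lq_norm_le_const:
  assumes "1 \<le> m" "2 \<le> q" "\<And>i. i < m \<Longrightarrow> \<bar>x i\<bar> \<le> r"
  shows "lq_norm q m x \<le> m powr (real_of_ereal (1 / q)) * r"
proof -
  have r: "0 \<le> r" using assms(3)[of 0] assms(1) by auto
  show ?thesis
    using assms(2)
  proof (cases rule: lq_exponent_cases)
    case 1
    have "(MAX i\<in>{..<m}. \<bar>x i\<bar>) \<le> r" using assms by (intro Max.boundedI) (auto simp: lessThan_empty_iff)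
    then show ?thesis using assms(1) by (simp add: 1 lq_norm_infinity)
  next
    case (2 p)
    have "(\<Sum>i<m. \<bar>x i\<bar> powr p) \<le> (\<Sum>i<m. r powr p)"
      using assms(3) 2 by (intro sum_mono powr_mono2) auto
    then have "(\<Sum>i<m. \<bar>x i\<bar> powr p) powr (1 / p) \<le> (m * r powr p) powr (1 / p)"
      using 2 by (intro powr_mono2) (auto simp: sum_nonneg)
    also have "\<dots> = m powr (1 / p) * r" using r 2 by (simp add: powr_mult powr_powr)
    finally show ?thesis using 2 by (simp add: lq_norm_finite one_ereal_def)
  qed
qed

lemma lq_norm_le_L2:
  assumes "1 \<le> m" "2 \<le> q"
  shows "lq_norm q m x \<le> L2_set x {..<m}"
  using assms(2)
proof (cases rule: lq_exponent_cases)
  case 1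
  have "\<bar>x i\<bar> \<le> L2_set x {..<m}" if "i < m" for i
  proof -
    have "L2_set (\<lambda>i. \<bar>x i\<bar>) {..<m} = L2_set x {..<m}" by (simp add: L2_set_def)
    then show ?thesis using member_le_L2_set[of "{..<m}" i "\<lambda>i. \<bar>x i\<bar>"] that by simp
  qed
  then show ?thesis using assms(1) by (auto simp: 1 lq_norm_infinity lessThan_empty_iff intro!: Max.boundedI)
next
  case (2 p)
  define c where "c = L2_set x {..<m}"
  have c: "0 \<le> c" by (simp add: c_def L2_set_nonneg)
  have x_le: "\<bar>x i\<bar> \<le> c" if "i < m" for i
  proof -
    have "L2_set (\<lambda>i. \<bar>x i\<bar>) {..<m} = L2_set x {..<m}" by (simp add: L2_set_def)
    then show ?thesis using member_le_L2_set[of "{..<m}" i "\<lambda>i. \<bar>x i\<bar>"] that by (simp add: c_def)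
  qed
  have "\<bar>x i\<bar> powr p \<le> c powr (p - 2) * (x i)\<^sup>2" if "i < m" for i
  proof (cases "x i = 0")
    case False
    have "\<bar>x i\<bar> powr p = \<bar>x i\<bar> powr (p - 2) * \<bar>x i\<bar> powr 2"
      unfolding powr_add[symmetric] by simp
    also have "\<dots> \<le> c powr (p - 2) * \<bar>x i\<bar> powr 2"
      using x_le[OF that] 2 by (intro mult_right_mono powr_mono2) auto
    also have "\<bar>x i\<bar> powr 2 = (x i)\<^sup>2" using False by simp
    finally show ?thesis .
  qed simp
  then have "(\<Sum>i<m. \<bar>x i\<bar> powr p) \<le> (\<Sum>i<m. c powr (p - 2) * (x i)\<^sup>2)"
    by (intro sum_mono) auto
  also have "\<dots> = c powr (p - 2) * (\<Sum>i<m. (x i)\<^sup>2)"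
    by (rule sum_distrib_left[symmetric])
  also have "(\<Sum>i<m. (x i)\<^sup>2) = c\<^sup>2"
    by (simp add: c_def L2_set_def sum_nonneg)
  also have "c powr (p - 2) * c\<^sup>2 = c powr p"
  proof (cases "c = 0")
    case False
    then have "c\<^sup>2 = c powr 2" using c by simp
    then show ?thesis unfolding \<open>c\<^sup>2 = c powr 2\<close> powr_add[symmetric] by simp
  qed simp
  finally have "(\<Sum>i<m. \<bar>x i\<bar> powr p) powr (1 / p) \<le> (c powr p) powr (1 / p)"
    using 2 by (intro powr_mono2) (auto simp: sum_nonneg)
  then show ?thesis using 2 c by (simp add: lq_norm_finite powr_powr c_def)
qed

lemma INF_diff_le:
  fixes f g :: "'a \<Rightarrow> real"
  assumes "A \<noteq> {}" "\<And>a. a \<in> A \<Longrightarrow> 0 \<le> f a" "\<And>a. a \<in> A \<Longrightarrow> f a \<le> g a + c"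
  shows "(INF a\<in>A. f a) \<le> (INF a\<in>A. g a) + c"
proof -
  have "(INF a\<in>A. f a) - c \<le> (INF a\<in>A. g a)"
  proof (rule cINF_greatest[OF assms(1)])
    fix a assume "a \<in> A"
    then have "(INF a\<in>A. f a) \<le> f a" using assms(2) by (intro cINF_lower bdd_belowI2)
    then show "(INF a\<in>A. f a) - c \<le> g a" using assms(3)[OF \<open>a \<in> A\<close>] by linarith
  qed
  then show ?thesis by linarith
qed

context
  fixes m :: nat and q :: ereal and E :: "(nat \<Rightarrow> real) set"
  assumes m: "1 \<le> m" and q: "2 \<le> q" and E: "E \<noteq> {}"
begin

lemma lq_dist_nonneg: "0 \<le> lq_dist q m x E"
  unfolding lq_dist_def by (rule cINF_greatest[OF E]) (rule lq_norm_nonneg[OF m q])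

lemma lq_dist_diff_le: "lq_dist q m x E \<le> lq_dist q m y E + lq_norm q m (\<lambda>i. x i - y i)"
  unfolding lq_dist_def
proof (rule INF_diff_le[OF E lq_norm_nonneg[OF m q]])
  fix z
  show "lq_norm q m (\<lambda>i. x i - z i) \<le> lq_norm q m (\<lambda>i. y i - z i) + lq_norm q m (\<lambda>i. x i - y i)"
    using lq_norm_triangle[OF m q, of "\<lambda>i. y i - z i" "\<lambda>i. x i - y i"] by simp
qed

context
  fixes n :: nat and Q :: "(nat \<Rightarrow> real) set"
  assumes Q: "Q \<noteq> {}" "\<And>\<sigma>. \<sigma> \<in> Q \<Longrightarrow> L2_set \<sigma> {..<n} \<le> 1"
begin

text \<open>
  An infimum changes by at most the largest change of its members, and by Cauchy-Schwarz no coordinate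
  of \<open>A \<sigma> - B \<sigma>\<close> exceeds the length of the corresponding row of \<open>A - B\<close>.
\<close>

lemma lq_margin_diff_le:
  "lq_margin q m n Q E A \<le> lq_margin q m n Q E B + lq_norm q m (\<lambda>i. L2_set (\<lambda>j. A (i, j) - B (i, j)) {..<n})"
  unfolding lq_margin_def
proof (rule INF_diff_le[OF Q(1) lq_dist_nonneg])
  fix \<sigma> assume "\<sigma> \<in> Q"
  let ?row = "\<lambda>i. L2_set (\<lambda>j. A (i, j) - B (i, j)) {..<n}"
  have "\<bar>mat_vec m n A \<sigma> i - mat_vec m n B \<sigma> i\<bar> \<le> \<bar>?row i\<bar>" if "i < m" for i
  proof -
    have "mat_vec m n A \<sigma> i - mat_vec m n B \<sigma> i = (\<Sum>j<n. (A (i, j) - B (i, j)) * \<sigma> j)"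
      using that by (simp add: mat_vec_def left_diff_distrib sum_subtractf)
    also have "\<bar>\<dots>\<bar> \<le> (\<Sum>j<n. \<bar>A (i, j) - B (i, j)\<bar> * \<bar>\<sigma> j\<bar>)"
      by (rule order_trans[OF sum_abs]) (simp add: abs_mult)
    also have "\<dots> \<le> ?row i * L2_set \<sigma> {..<n}"
      by (rule L2_set_mult_ineq)
    also have "\<dots> \<le> ?row i * 1"
      using Q(2)[OF \<open>\<sigma> \<in> Q\<close>] by (intro mult_left_mono) (auto simp: L2_set_nonneg)
    finally show ?thesis by simp
  qed
  then have "lq_norm q m (\<lambda>i. mat_vec m n A \<sigma> i - mat_vec m n B \<sigma> i) \<le> lq_norm q m ?row"
    by (intro lq_norm_mono[OF m q])
  then show "lq_dist q m (mat_vec m n A \<sigma>) E \<le> lq_dist q m (mat_vec m n B \<sigma>) E + lq_norm q m ?row"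
    using lq_dist_diff_le[of "mat_vec m n A \<sigma>" "mat_vec m n B \<sigma>"] by linarith
qed

lemma lq_margin_row_lipschitz:
  "row_lipschitz m n (real_of_ereal (1 / q)) (lq_margin q m n Q E)"
proof -
  have incr: "\<bar>lq_margin q m n Q E (\<lambda>a. x a + H a) - lq_margin q m n Q E x\<bar>
      \<le> lq_norm q m (\<lambda>i. L2_set (\<lambda>j. H (i, j)) {..<n})" for x H
    using lq_margin_diff_le[of "\<lambda>a. x a + H a" x] lq_margin_diff_le[of x "\<lambda>a. x a + H a"]
    by (simp add: L2_set_def)
  have "lq_norm q m (\<lambda>i. L2_set (\<lambda>j. H (i, j)) {..<n}) \<le> L2_set H (cells m n)" for H
  proof -
    have "L2_set (\<lambda>i. L2_set (\<lambda>j. H (i, j)) {..<n}) {..<m} = L2_set H (cells m n)"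
      by (simp add: L2_set_def sum_nonneg sum.cartesian_product)
    then show ?thesis using lq_norm_le_L2[OF m q] by metis
  qed
  moreover have "lq_norm q m (\<lambda>i. L2_set (\<lambda>j. H (i, j)) {..<n}) \<le> m powr (real_of_ereal (1 / q)) * r"
    if "\<forall>i<m. L2_set (\<lambda>j. H (i, j)) {..<n} \<le> r" for H r
    using that by (intro lq_norm_le_const[OF m q]) (simp add: L2_set_nonneg)
  ultimately show ?thesis
    unfolding row_lipschitz_def using incr order_trans by blast
qed

end
end

lemma lq_norm_permute:
  assumes "\<pi> permutes {..<m}"
  shows "lq_norm q m (\<lambda>i. x (\<pi> i)) = lq_norm q m x"
proof -
  have "(\<Sum>i<m. \<bar>x (\<pi> i)\<bar> powr p) = (\<Sum>i<m. \<bar>x i\<bar> powr p)" for p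
    using sum.permute[OF assms, of "\<lambda>i. \<bar>x i\<bar> powr p"] by (simp add: comp_def)
  moreover have "(\<lambda>i. \<bar>x (\<pi> i)\<bar>) ` {..<m} = (\<lambda>i. \<bar>x i\<bar>) ` {..<m}"
    using permutes_image[OF assms] by (metis image_image)
  ultimately show ?thesis by (simp add: lq_norm_def)
qed

text \<open>
  Permuting the coordinates preserves both the norm and \<open>E\<close>.
\<close>

lemma lq_dist_permute:
  assumes E: "E \<subseteq> topspace (Euclidean_space m)" and sym: "permutation_symmetric m E"
    and \<pi>: "\<pi> permutes {..<m}"
  shows "lq_dist q m (\<lambda>i. x (\<pi> i)) E = lq_dist q m x E"
proof -
  have permute_E: "(\<lambda>i. y (\<rho> i)) \<in> E" if "y \<in> E" "\<rho> permutes {..<m}" for y \<rho>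
    using sym that E unfolding permutation_symmetric_def by blast
  have "(\<lambda>y i. y (\<pi> i)) ` E = E"
  proof (intro equalityI subsetI)
    fix y assume "y \<in> E"
    then have "(\<lambda>i. y (inv \<pi> i)) \<in> E" by (rule permute_E) (rule permutes_inv[OF \<pi>])
    moreover have "y = (\<lambda>i. (\<lambda>i. y (inv \<pi> i)) (\<pi> i))" using permutes_inverses[OF \<pi>] by simp
    ultimately show "y \<in> (\<lambda>y i. y (\<pi> i)) ` E"
      by (intro image_eqI[where x = "\<lambda>i. y (inv \<pi> i)"])
  qed (use permute_E \<pi> in auto)
  then have "lq_dist q m (\<lambda>i. x (\<pi> i)) E = (INF y\<in>(\<lambda>y i. y (\<pi> i)) ` E. lq_norm q m (\<lambda>i. x (\<pi> i) - y i))"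
    by (simp add: lq_dist_def)
  also have "\<dots> = (INF y\<in>E. lq_norm q m (\<lambda>i. x (\<pi> i) - y (\<pi> i)))"
    by (simp add: image_image)
  also have "\<dots> = lq_dist q m x E"
  proof -
    have "lq_norm q m (\<lambda>i. x (\<pi> i) - y (\<pi> i)) = lq_norm q m (\<lambda>i. x i - y i)" for y
      using lq_norm_permute[OF \<pi>, of q "\<lambda>i. x i - y i"] .
    then show ?thesis by (simp add: lq_dist_def)
  qed
  finally show ?thesis .
qed

lemma lq_margin_row_perms:
  assumes E: "E \<subseteq> topspace (Euclidean_space m)" and sym: "permutation_symmetric m E"
    and p: "p \<in> row_perms m"
  shows "lq_margin q m n Q E (A \<circ> p) = lq_margin q m n Q E A"
proof -
  obtain \<pi> where \<pi>: "\<pi> permutes {..<m}" and p: "p = (\<lambda>(i, j). (\<pi> i, j))"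
    using p by (auto simp: row_perms_def)
  have "mat_vec m n (A \<circ> p) \<sigma> = (\<lambda>i. mat_vec m n A \<sigma> (\<pi> i))" for \<sigma>
  proof
    fix i
    have "\<pi> i < m \<longleftrightarrow> i < m" using permutes_in_image[OF \<pi>, of i] by simp
    then show "mat_vec m n (A \<circ> p) \<sigma> i = mat_vec m n A \<sigma> (\<pi> i)" by (simp add: mat_vec_def p)
  qed
  then show ?thesis
    by (simp add: lq_margin_def lq_dist_permute[OF E sym \<pi>])
qed

text \<open>
  The constant \<open>5\<close> comes from the bound for row-symmetric functions with \<open>\<theta> = 1 / q\<close>, whose denominator
  is at least as large, with \<open>1 - 2 / q\<close> in the place of \<open>1 / 2 - 1 / q\<close>.
\<close>

theorem theorem1p3:
  shows "\<exists>C>0. \<forall>(M::nat) (N::nat) (Q::(nat \<Rightarrow> real) set) (E::(nat \<Rightarrow> real) set) (q::ereal).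
    M \<ge> 1 \<longrightarrow> N \<ge> 1 \<longrightarrow>
    Q \<noteq> {} \<longrightarrow> Q \<subseteq> topspace (Euclidean_space N) \<longrightarrow> (\<forall>\<sigma>\<in>Q. L2_set \<sigma> {..<N} \<le> 1) \<longrightarrow>
    E \<noteq> {} \<longrightarrow> closedin (Euclidean_space M) E \<longrightarrow> permutation_symmetric M E \<longrightarrow>
    2 \<le> q \<longrightarrow>
      integrable (gaussian_matrix M N) (lq_margin q M N Q E) \<and>
      integrable (gaussian_matrix M N) (\<lambda>A. (lq_margin q M N Q E A)\<^sup>2) \<and>
      prob_space.variance (gaussian_matrix M N) (lq_margin q M N Q E)
        \<le> C / (1 + (1 / 2 - real_of_ereal (1 / q)) * ln (real M))"
proof (intro exI[of _ 5] conjI allI impI)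
  fix M N :: nat and Q E :: "(nat \<Rightarrow> real) set" and q :: ereal
  assume M: "M \<ge> 1" and Q: "Q \<noteq> {}" "\<forall>\<sigma>\<in>Q. L2_set \<sigma> {..<N} \<le> 1"
    and E: "E \<noteq> {}" "closedin (Euclidean_space M) E" "permutation_symmetric M E" and q: "2 \<le> q"
  define \<theta> where "\<theta> = real_of_ereal (1 / q)"
  have \<theta>: "\<theta> \<le> 1 / 2"
    using q by (cases rule: lq_exponent_cases) (auto simp: \<theta>_def one_ereal_def field_simps)
  have lip: "row_lipschitz M N \<theta> (lq_margin q M N Q E)"
    unfolding \<theta>_def using Q by (intro lq_margin_row_lipschitz[OF M q E(1)]) auto
  have sym: "lq_margin q M N Q E (A \<circ> p) = lq_margin q M N Q E A" if "p \<in> row_perms M" for p A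
    by (rule lq_margin_row_perms[OF closedin_subset[OF E(2)] E(3) that])
  note bound = gaussian_variance_row_symmetric[where f = "lq_margin q M N Q E", OF M \<theta> lip sym, folded gaussian_matrix_def]
  show "integrable (gaussian_matrix M N) (lq_margin q M N Q E)" by (rule bound(1))
  show "integrable (gaussian_matrix M N) (\<lambda>A. (lq_margin q M N Q E A)\<^sup>2)" by (rule bound(2))
  have "(1 / 2 - \<theta>) * ln M \<le> (1 - 2 * \<theta>) * ln M" "0 \<le> (1 / 2 - \<theta>) * ln M"
    using M \<theta> by (auto intro!: mult_right_mono)
  then have "5 / (1 + (1 - 2 * \<theta>) * ln M) \<le> 5 / (1 + (1 / 2 - \<theta>) * ln M)"
    by (intro divide_left_mono mult_pos_pos) linarith+
  then show "prob_space.variance (gaussian_matrix M N) (lq_margin q M N Q E)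
      \<le> 5 / (1 + (1 / 2 - real_of_ereal (1 / q)) * ln (real M))"
    using bound(3) by (simp add: \<theta>_def)
qed simp

end
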